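(* Let $R$ be a ring. Every left $R$-module is elementarily equivalent to, in fact an elementary submodule of, a left $R$-module of Ulm length $\le 1$.
   Context: Rings are associative with $1$, modules are unitary left modules; elementary equivalence and elementary submodules are with respect to the first-order language of left $R$-modules. A unary pp formula is a formula $\phi(x)=\exists\bar y\,(A\bar y=\mathbf bx)$ with $A$ an $n\times m$ matrix and $\mathbf b$ a column of length $n$ over $R$; $\phi(M)$ is the additive subgroup it defines in $M$. The formula $\phi$ is high if $\phi(E)=E$ for every injective (equivalently, every absolutely pure) left $R$-module $E$. The first Ulm submodule of $M$ is $\mathfrak u(M)=\bigcap\{\phi(M):\phi\text{ a high unary pp formula}\}$, which is a submodule of $M$. Put $\mathfrak u^0(M)=M$, $\mathfrak u^{\alpha+1}(M)=\mathfrak u(\mathfrak u^\alpha(M))$ and $\mathfrak u^\delta(M)=\bigcap_{\alpha<\delta}\mathfrak u^\alpha(M)$ for limit ordinals $\delta$. The Ulm length of $M$ is the least ordinal $\tau$ with $\mathfrak u^{\tau+1}(M)=\mathfrak u^\tau(M)$. *)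

theory Defs
  imports "HOL-Algebra.Module"
begin

unbundle cardinal_syntax

section \<open>Left modules\<close>

text \<open>The library locale \<^locale>\<open>module\<close> requires a commutative scalar ring; the following is the
  same locale over an arbitrary ring with 1 (the zero ring included). As in the library, the
  fields \<open>mult\<close> and \<open>one\<close> of the module record carry no meaning.\<close>

locale left_module = R?: ring R + M?: abelian_group M for R (structure) and M (structure) +
  assumes smult_closed [simp, intro]:
      "\<lbrakk>a \<in> carrier R; x \<in> carrier M\<rbrakk> \<Longrightarrow> a \<odot>\<^bsub>M\<^esub> x \<in> carrier M"
    and smult_l_distr:
      "\<lbrakk>a \<in> carrier R; b \<in> carrier R; x \<in> carrier M\<rbrakk> \<Longrightarrow>
      (a \<oplus> b) \<odot>\<^bsub>M\<^esub> x = a \<odot>\<^bsub>M\<^esub> x \<oplus>\<^bsub>M\<^esub> b \<odot>\<^bsub>M\<^esub> x"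
    and smult_r_distr:
      "\<lbrakk>a \<in> carrier R; x \<in> carrier M; y \<in> carrier M\<rbrakk> \<Longrightarrow>
      a \<odot>\<^bsub>M\<^esub> (x \<oplus>\<^bsub>M\<^esub> y) = a \<odot>\<^bsub>M\<^esub> x \<oplus>\<^bsub>M\<^esub> a \<odot>\<^bsub>M\<^esub> y"
    and smult_assoc1:
      "\<lbrakk>a \<in> carrier R; b \<in> carrier R; x \<in> carrier M\<rbrakk> \<Longrightarrow>
      (a \<otimes> b) \<odot>\<^bsub>M\<^esub> x = a \<odot>\<^bsub>M\<^esub> (b \<odot>\<^bsub>M\<^esub> x)"
    and smult_one [simp]:
      "x \<in> carrier M \<Longrightarrow> \<one> \<odot>\<^bsub>M\<^esub> x = x"

definition lin_maps :: "('r, 'x) ring_scheme \<Rightarrow> ('r, 'a) module \<Rightarrow> ('r, 'b) module \<Rightarrow> ('a \<Rightarrow> 'b) set"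
  where "lin_maps R M N = {f \<in> carrier M \<rightarrow> carrier N.
    (\<forall>x\<in>carrier M. \<forall>y\<in>carrier M. f (x \<oplus>\<^bsub>M\<^esub> y) = f x \<oplus>\<^bsub>N\<^esub> f y) \<and>
    (\<forall>r\<in>carrier R. \<forall>x\<in>carrier M. f (r \<odot>\<^bsub>M\<^esub> x) = r \<odot>\<^bsub>N\<^esub> f x)}"


section \<open>First-order language of left modules\<close>

datatype 'r mterm = Var nat | Zero | Neg "'r mterm" | Add "'r mterm" "'r mterm" | Scal 'r "'r mterm"

datatype 'r mform = FEq "'r mterm" "'r mterm" | FNot "'r mform" | FAnd "'r mform" "'r mform"
  | FEx nat "'r mform"

text \<open>\<open>set_mform \<phi>\<close> (generated by the datatype package) is the set of scalars occurring in \<open>\<phi>\<close>; \<open>\<phi>\<close> is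
  a formula of the language of left \<open>R\<close>-modules iff it is contained in \<open>carrier R\<close>.\<close>

primrec tval :: "('r, 'm) module \<Rightarrow> (nat \<Rightarrow> 'm) \<Rightarrow> 'r mterm \<Rightarrow> 'm" where
  "tval M s (Var i) = s i"
| "tval M s Zero = \<zero>\<^bsub>M\<^esub>"
| "tval M s (Neg t) = \<ominus>\<^bsub>M\<^esub> tval M s t"
| "tval M s (Add t u) = tval M s t \<oplus>\<^bsub>M\<^esub> tval M s u"
| "tval M s (Scal r t) = r \<odot>\<^bsub>M\<^esub> tval M s t"

primrec sat :: "('r, 'm) module \<Rightarrow> (nat \<Rightarrow> 'm) \<Rightarrow> 'r mform \<Rightarrow> bool" where
  "sat M s (FEq t u) \<longleftrightarrow> tval M s t = tval M s u"
| "sat M s (FNot \<phi>) \<longleftrightarrow> \<not> sat M s \<phi>"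
| "sat M s (FAnd \<phi> \<psi>) \<longleftrightarrow> sat M s \<phi> \<and> sat M s \<psi>"
| "sat M s (FEx i \<phi>) \<longleftrightarrow> (\<exists>x\<in>carrier M. sat M (s(i := x)) \<phi>)"

primrec tvars :: "'r mterm \<Rightarrow> nat set" where
  "tvars (Var i) = {i}"
| "tvars Zero = {}"
| "tvars (Neg t) = tvars t"
| "tvars (Add t u) = tvars t \<union> tvars u"
| "tvars (Scal r t) = tvars t"

primrec fvars :: "'r mform \<Rightarrow> nat set" where
  "fvars (FEq t u) = tvars t \<union> tvars u"
| "fvars (FNot \<phi>) = fvars \<phi>"
| "fvars (FAnd \<phi> \<psi>) = fvars \<phi> \<union> fvars \<psi>"
| "fvars (FEx i \<phi>) = fvars \<phi> - {i}"

text \<open>The assignment chosen for a sentence is irrelevant.\<close>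

definition elementarily_equivalent ::
  "('r, 'x) ring_scheme \<Rightarrow> ('r, 'a) module \<Rightarrow> ('r, 'b) module \<Rightarrow> bool" where
  "elementarily_equivalent R M N \<longleftrightarrow>
    (\<forall>\<phi>. set_mform \<phi> \<subseteq> carrier R \<and> fvars \<phi> = {} \<longrightarrow>
       (sat M (\<lambda>_. \<zero>\<^bsub>M\<^esub>) \<phi> \<longleftrightarrow> sat N (\<lambda>_. \<zero>\<^bsub>N\<^esub>) \<phi>))"

definition elementary_submodule :: "'m set \<Rightarrow> ('r, 'x) ring_scheme \<Rightarrow> ('r, 'm) module \<Rightarrow> bool" where
  "elementary_submodule H R N \<longleftrightarrow> submodule H R N \<and>
    (\<forall>\<phi> s. set_mform \<phi> \<subseteq> carrier R \<and> range s \<subseteq> H \<longrightarrow>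
       (sat (N\<lparr>carrier := H\<rparr>) s \<phi> \<longleftrightarrow> sat N s \<phi>))"


section \<open>Unary pp formulas\<close>

text \<open>\<open>PP n m A b\<close> stands for \<open>\<exists>y\<^sub>0\<dots>y\<^sub>m\<^sub>-\<^sub>1. \<And>i<n. \<Sum>j<m. A i j y\<^sub>j = b i x\<close>; values of \<open>A\<close> and \<open>b\<close> outside the
  index ranges \<open>i < n\<close>, \<open>j < m\<close> are ignored.\<close>

datatype 'r pp = PP nat nat "nat \<Rightarrow> nat \<Rightarrow> 'r" "nat \<Rightarrow> 'r"

fun pp_over :: "('r, 'x) ring_scheme \<Rightarrow> 'r pp \<Rightarrow> bool" where
  "pp_over R (PP n m A b) \<longleftrightarrow>
    (\<forall>i<n. b i \<in> carrier R) \<and> (\<forall>i<n. \<forall>j<m. A i j \<in> carrier R)"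

fun pp_set :: "'r pp \<Rightarrow> ('r, 'm) module \<Rightarrow> 'm set" where
  "pp_set (PP n m A b) M = {x \<in> carrier M. \<exists>y. (\<forall>j<m. y j \<in> carrier M) \<and>
     (\<forall>i<n. (\<Oplus>\<^bsub>M\<^esub>j\<in>{..<m}. A i j \<odot>\<^bsub>M\<^esub> y j) = b i \<odot>\<^bsub>M\<^esub> x)}"


section \<open>Injective modules and high formulas\<close>

text \<open>A definition cannot quantify over all types. The quantifiers over ``all modules'' in the
  notions of injective module and high formula range over the modules whose carrier lies in the
  following type, of cardinality \<open>2\<close> to the power \<open>max(\<bar>'r\<bar>, \<aleph>\<^sub>0)\<close>. Lemmas \<open>injective_any_type\<close> and
  \<open>high_any_type\<close> show that this is no restriction: both properties then hold with respect to
  modules over every type.\<close>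

type_synonym 'r univ = "('r + nat) list set"

definition injective :: "('r, 'x) ring_scheme \<Rightarrow> ('r, 'e) module \<Rightarrow> bool" where
  "injective R E \<longleftrightarrow> left_module R E \<and>
    (\<forall>(A :: ('r, 'r univ) module) (B :: ('r, 'r univ) module) i f.
       left_module R A \<and> left_module R B \<and> i \<in> lin_maps R A B \<and> inj_on i (carrier A) \<and>
       f \<in> lin_maps R A E \<longrightarrow>
       (\<exists>g \<in> lin_maps R B E. \<forall>x\<in>carrier A. g (i x) = f x))"

definition high :: "('r, 'x) ring_scheme \<Rightarrow> 'r pp \<Rightarrow> bool" where
  "high R \<phi> \<longleftrightarrow> pp_over R \<phi> \<and>
    (\<forall>E :: ('r, 'r univ) module. injective R E \<longrightarrow> pp_set \<phi> E = carrier E)"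


section \<open>Ulm submodules and Ulm length\<close>

definition ulm :: "('r, 'x) ring_scheme \<Rightarrow> ('r, 'm) module \<Rightarrow> ('r, 'm) module" where
  "ulm R M = M\<lparr>carrier := \<Inter>\<phi>\<in>{\<phi>. high R \<phi>}. pp_set \<phi> M\<rparr>"

text \<open>Ordinals are represented by well-orders \<open>r\<close> (reflexive relations on their field), compared by
  \<open><o\<close>. The ordinal of \<open>r\<close> is \<open>0\<close> iff the field is empty; it is a successor iff \<open>r\<close> has a greatest
  element \<open>m\<close>, and then its predecessor is represented by \<open>r\<close> restricted to the elements strictly
  below \<open>m\<close>. Every ordinal below that of \<open>r\<close> is represented by a well-order on the same type.\<close>

definition is_greatest :: "'o rel \<Rightarrow> 'o \<Rightarrow> bool" where
  "is_greatest r m \<longleftrightarrow> m \<in> Field r \<and> (\<forall>a\<in>Field r. (a, m) \<in> r)"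

function ulm_pow :: "('r, 'x) ring_scheme \<Rightarrow> ('r, 'm) module \<Rightarrow> 'o rel \<Rightarrow> ('r, 'm) module" where
  "ulm_pow R M r =
    (if \<not> Well_order r then undefined
     else if Field r = {} then M
     else if \<exists>m. is_greatest r m
       then ulm R (ulm_pow R M (Restr r (underS r (THE m. is_greatest r m))))
     else M\<lparr>carrier := \<Inter>s\<in>{s. s <o r}. carrier (ulm_pow R M s)\<rparr>)"
  by pat_completeness auto
termination
proof (relation "inv_image ordLess (\<lambda>(R, M, r). r)", goal_cases)
  case 1
  show ?case by (simp add: wf_ordLess)
next
  case (2 R M r)
  then obtain m where m: "is_greatest r m" by blast
  have anti: "antisym r"
    using 2 by (simp add: well_order_on_def linear_order_on_def partial_order_on_def)
  have eq: "(THE m. is_greatest r m) = m"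
    using m anti by (intro the_equality) (auto simp: is_greatest_def antisym_def)
  have "m \<in> Field r"
    using m by (simp add: is_greatest_def)
  then show ?case
    using 2 underS_Restr_ordLess[of r m] by (simp add: eq)
next
  case 3
  then show ?case by simp
qed

declare ulm_pow.simps [simp del]

definition is_ulm_length :: "('r, 'x) ring_scheme \<Rightarrow> ('r, 'm) module \<Rightarrow> 'o rel \<Rightarrow> bool" where
  "is_ulm_length R M \<tau> \<longleftrightarrow> Well_order \<tau> \<and>
    carrier (ulm R (ulm_pow R M \<tau>)) = carrier (ulm_pow R M \<tau>) \<and>
    (\<forall>\<sigma> :: 'o rel. \<sigma> <o \<tau> \<longrightarrow>
       carrier (ulm R (ulm_pow R M \<sigma>)) \<noteq> carrier (ulm_pow R M \<sigma>))"

text \<open>A type with room for the carrier of a suitable elementary extension of a module with elements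
  in \<open>'m\<close>: classes of functions into \<open>'m\<close>, as in an ultrapower iterated along \<open>nat\<close>. It only serves
  as a sufficiently large type.\<close>

type_synonym ('r, 'm) ext = "((nat \<Rightarrow> 'r pp set) \<Rightarrow> 'm) set"


section \<open>Independence of the type of modules quantified over\<close>

context left_module
begin

lemma smult_l_null: 
  assumes "x \<in> carrier M" shows "\<zero> \<odot>\<^bsub>M\<^esub> x = \<zero>\<^bsub>M\<^esub>"
proof -
  have "\<zero> \<odot>\<^bsub>M\<^esub> x \<oplus>\<^bsub>M\<^esub> \<zero> \<odot>\<^bsub>M\<^esub> x = \<zero> \<odot>\<^bsub>M\<^esub> x"
    using assms smult_l_distr[of \<zero> \<zero> x] by simp
  then show ?thesis
    using assms by (metis M.add.r_cancel_one' R.zero_closed smult_closed)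
qed

lemma smult_minus_one:
  assumes "x \<in> carrier M" shows "(\<ominus> \<one>) \<odot>\<^bsub>M\<^esub> x = \<ominus>\<^bsub>M\<^esub> x"
proof -
  have "(\<ominus> \<one>) \<odot>\<^bsub>M\<^esub> x \<oplus>\<^bsub>M\<^esub> x = \<zero>\<^bsub>M\<^esub>"
    using assms smult_l_distr[of "\<ominus> \<one>" \<one> x] by (simp add: smult_l_null R.l_neg)
  then show ?thesis
    using assms by (simp add: M.minus_equality)
qed

lemma add_exchange:
  assumes "x \<in> carrier M" "y \<in> carrier M" "z \<in> carrier M" "w \<in> carrier M"
  shows "(x \<oplus>\<^bsub>M\<^esub> y) \<oplus>\<^bsub>M\<^esub> (z \<oplus>\<^bsub>M\<^esub> w) = (x \<oplus>\<^bsub>M\<^esub> z) \<oplus>\<^bsub>M\<^esub> (y \<oplus>\<^bsub>M\<^esub> w)"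
  using assms by (simp add: M.a_ac)

lemma restrict_left_module:
  assumes sub: "H \<subseteq> carrier M" and ne: "H \<noteq> {}"
    and add: "\<And>x y. x \<in> H \<Longrightarrow> y \<in> H \<Longrightarrow> x \<oplus>\<^bsub>M\<^esub> y \<in> H"
    and smul: "\<And>r x. r \<in> carrier R \<Longrightarrow> x \<in> H \<Longrightarrow> r \<odot>\<^bsub>M\<^esub> x \<in> H"
  shows "left_module R (M\<lparr>carrier := H\<rparr>)"
proof -
  obtain h where h: "h \<in> H" using ne by blast
  have z: "\<zero>\<^bsub>M\<^esub> \<in> H"
    using smul[OF R.zero_closed h] h sub smult_l_null by auto
  have m: "\<ominus>\<^bsub>M\<^esub> x \<in> H" if "x \<in> H" for x
    using smul[OF R.a_inv_closed[OF R.one_closed] that] that sub smult_minus_one by auto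
  have in': "x \<in> carrier M" if "x \<in> H" for x using that sub by blast
  have "abelian_group (M\<lparr>carrier := H\<rparr>)"
  proof (rule abelian_groupI)
    fix x assume "x \<in> carrier (M\<lparr>carrier := H\<rparr>)"
    then show "\<exists>y\<in>carrier (M\<lparr>carrier := H\<rparr>). y \<oplus>\<^bsub>M\<lparr>carrier := H\<rparr>\<^esub> x = \<zero>\<^bsub>M\<lparr>carrier := H\<rparr>\<^esub>"
      using m in' by (intro bexI[of _ "\<ominus>\<^bsub>M\<^esub> x"]) (auto simp: M.l_neg)
  qed (auto simp: add z in' M.a_ac)
  then show ?thesis
    unfolding left_module_def left_module_axioms_def
    by (auto simp: R.ring_axioms smul in' smult_l_distr smult_r_distr smult_assoc1)
qed

end

lemma pp_set_lin_map:
  assumes R: "left_module R M" "left_module R N" and f: "f \<in> lin_maps R M N"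
    and ov: "pp_over R \<phi>" and x: "x \<in> pp_set \<phi> M"
  shows "f x \<in> pp_set \<phi> N"
proof -
  interpret M: left_module R M by fact
  interpret N: left_module R N by fact
  obtain n m A b where \<phi>: "\<phi> = PP n m A b" by (cases \<phi>)
  obtain y where y: "\<forall>j<m. y j \<in> carrier M" 
    "\<forall>i<n. (\<Oplus>\<^bsub>M\<^esub>j\<in>{..<m}. A i j \<odot>\<^bsub>M\<^esub> y j) = b i \<odot>\<^bsub>M\<^esub> x" and xM: "x \<in> carrier M"
    using x unfolding \<phi> by auto
  have fc: "f z \<in> carrier N" if "z \<in> carrier M" for z using that f by (auto simp: lin_maps_def)
  have fa: "f (z \<oplus>\<^bsub>M\<^esub> w) = f z \<oplus>\<^bsub>N\<^esub> f w" if "z \<in> carrier M" "w \<in> carrier M" for z w 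
    using that f by (auto simp: lin_maps_def)
  have fs: "f (r \<odot>\<^bsub>M\<^esub> w) = r \<odot>\<^bsub>N\<^esub> f w" if "r \<in> carrier R" "w \<in> carrier M" for r w 
    using that f by (auto simp: lin_maps_def)
  have fz: "f \<zero>\<^bsub>M\<^esub> = \<zero>\<^bsub>N\<^esub>"
    using fs[of "\<zero>\<^bsub>R\<^esub>" "\<zero>\<^bsub>M\<^esub>"] fc[of "\<zero>\<^bsub>M\<^esub>"] by (simp add: M.smult_l_null N.smult_l_null)
  have A: "A i j \<in> carrier R" if "i < n" "j < m" for i j using ov that by (simp add: \<phi>)
  have fin: "f (\<Oplus>\<^bsub>M\<^esub>j\<in>{..<k}. A i j \<odot>\<^bsub>M\<^esub> y j) = (\<Oplus>\<^bsub>N\<^esub>j\<in>{..<k}. A i j \<odot>\<^bsub>N\<^esub> f (y j))" 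
    if "i < n" "k \<le> m" for i k
    using that(2)
  proof (induction k)
    case 0
    then show ?case by (simp add: fz)
  next
    case (Suc k)
    have "(\<Oplus>\<^bsub>M\<^esub>j\<in>{..<Suc k}. A i j \<odot>\<^bsub>M\<^esub> y j) = A i k \<odot>\<^bsub>M\<^esub> y k \<oplus>\<^bsub>M\<^esub> (\<Oplus>\<^bsub>M\<^esub>j\<in>{..<k}. A i j \<odot>\<^bsub>M\<^esub> y j)"
      unfolding lessThan_Suc using Suc.prems y(1) A that(1) 
      by (intro M.finsum_insert) (auto intro!: M.smult_closed)
    moreover have "(\<Oplus>\<^bsub>N\<^esub>j\<in>{..<Suc k}. A i j \<odot>\<^bsub>N\<^esub> f (y j)) = A i k \<odot>\<^bsub>N\<^esub> f (y k) \<oplus>\<^bsub>N\<^esub> (\<Oplus>\<^bsub>N\<^esub>j\<in>{..<k}. A i j \<odot>\<^bsub>N\<^esub> f (y j))"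
      unfolding lessThan_Suc using Suc.prems y(1) A that(1) fc
      by (intro N.finsum_insert) (auto intro!: N.smult_closed)
    moreover have "(\<Oplus>\<^bsub>M\<^esub>j\<in>{..<k}. A i j \<odot>\<^bsub>M\<^esub> y j) \<in> carrier M"
    proof (rule M.finsum_closed, rule Pi_I)
      fix j assume "j \<in> {..<k}"
      then have "j < m" using Suc.prems by simp
      then show "A i j \<odot>\<^bsub>M\<^esub> y j \<in> carrier M" using A that(1) y(1) M.smult_closed by blast
    qed
    ultimately show ?case
      using Suc y(1) A that(1) by (simp add: fa fs M.smult_closed)
  qed
  show ?thesis
    unfolding \<phi> pp_set.simps mem_Collect_eq
  proof (intro conjI exI[of _ "\<lambda>j. f (y j)"] allI impI)
    show "f x \<in> carrier N" using fc xM by blast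
    show "f (y j) \<in> carrier N" if "j < m" for j using y fc that by blast
    show "(\<Oplus>\<^bsub>N\<^esub>j\<in>{..<m}. A i j \<odot>\<^bsub>N\<^esub> f (y j)) = b i \<odot>\<^bsub>N\<^esub> f x" if "i < n" for i
      using fin[OF that, of m] y(2) that fs[of "b i" x] xM ov by (simp add: \<phi>)
  qed
qed

definition transport :: "('a \<Rightarrow> 'b) \<Rightarrow> ('r, 'a) module \<Rightarrow> ('r, 'b) module" where
  "transport \<rho> M = (let \<iota> = inv_into (carrier M) \<rho> in
    \<lparr>carrier = \<rho> ` carrier M, monoid.mult = (\<lambda>x y. x), one = \<rho> \<zero>\<^bsub>M\<^esub>, zero = \<rho> \<zero>\<^bsub>M\<^esub>,
     add = (\<lambda>x y. \<rho> (\<iota> x \<oplus>\<^bsub>M\<^esub> \<iota> y)), smult = (\<lambda>r x. \<rho> (r \<odot>\<^bsub>M\<^esub> \<iota> x))\<rparr>)"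

lemma transport:
  assumes "left_module R M" and inj: "inj_on \<rho> (carrier M)"
  shows "left_module R (transport \<rho> M)" 
    and "\<rho> \<in> lin_maps R M (transport \<rho> M)"
    and "inv_into (carrier M) \<rho> \<in> lin_maps R (transport \<rho> M) M"
    and "carrier (transport \<rho> M) = \<rho> ` carrier M"
proof -
  interpret M: left_module R M by fact
  note [simp] = transport_def Let_def inv_into_f_f[OF inj]
  have "abelian_group (transport \<rho> M)"
  proof (rule abelian_groupI)
    fix x assume "x \<in> carrier (transport \<rho> M)"
    then obtain z where z: "z \<in> carrier M" "x = \<rho> z" by auto
    show "\<exists>y\<in>carrier (transport \<rho> M). y \<oplus>\<^bsub>transport \<rho> M\<^esub> x = \<zero>\<^bsub>transport \<rho> M\<^esub>"
      using z by (intro bexI[of _ "\<rho> (\<ominus>\<^bsub>M\<^esub> z)"]) (auto simp: M.M.l_neg)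
  qed (auto simp: M.M.a_ac)
  then show "left_module R (transport \<rho> M)" 
    unfolding left_module_def left_module_axioms_def
    by (auto simp: M.R.ring_axioms M.smult_l_distr M.smult_r_distr M.smult_assoc1)
  show "carrier (transport \<rho> M) = \<rho> ` carrier M" by simp
  show "\<rho> \<in> lin_maps R M (transport \<rho> M)" by (simp add: lin_maps_def)
  show "inv_into (carrier M) \<rho> \<in> lin_maps R (transport \<rho> M) M" by (auto simp: lin_maps_def)
qed

definition regular :: "('r, 'x) ring_scheme \<Rightarrow> ('r, 'r) module" where
  "regular R = \<lparr>carrier = carrier R, monoid.mult = monoid.mult R, one = \<one>\<^bsub>R\<^esub>, zero = \<zero>\<^bsub>R\<^esub>, add = add R, 
    smult = monoid.mult R\<rparr>"

lemma regular:
  assumes "ring R" shows "left_module R (regular R)"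
proof -
  interpret ring R by fact
  have "abelian_group (regular R)"
  proof (rule abelian_groupI)
    fix x assume "x \<in> carrier (regular R)"
    then show "\<exists>y\<in>carrier (regular R). y \<oplus>\<^bsub>regular R\<^esub> x = \<zero>\<^bsub>regular R\<^esub>"
      by (intro bexI[of _ "\<ominus>\<^bsub>R\<^esub> x"]) (auto simp: regular_def l_neg)
  qed (auto simp: regular_def a_ac)
  then show ?thesis
    unfolding left_module_def left_module_axioms_def
    by (auto simp: regular_def ring_axioms l_distr r_distr m_assoc)
qed

definition baer :: "('r, 'x) ring_scheme \<Rightarrow> ('r, 'e) module \<Rightarrow> bool" where
  "baer R E \<longleftrightarrow> (\<forall>I f. I \<subseteq> carrier R \<and> I \<noteq> {} \<and>
     (\<forall>x\<in>I. \<forall>y\<in>I. x \<oplus>\<^bsub>R\<^esub> y \<in> I \<and> f (x \<oplus>\<^bsub>R\<^esub> y) = f x \<oplus>\<^bsub>E\<^esub> f y) \<and>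
     (\<forall>r\<in>carrier R. \<forall>x\<in>I. r \<otimes>\<^bsub>R\<^esub> x \<in> I \<and> f (r \<otimes>\<^bsub>R\<^esub> x) = r \<odot>\<^bsub>E\<^esub> f x) \<and>
     f ` I \<subseteq> carrier E \<longrightarrow> (\<exists>c\<in>carrier E. \<forall>r\<in>I. f r = r \<odot>\<^bsub>E\<^esub> c))"

lemma baerD:
  assumes "baer R E" "I \<subseteq> carrier R" "I \<noteq> {}"
    "\<forall>x\<in>I. \<forall>y\<in>I. x \<oplus>\<^bsub>R\<^esub> y \<in> I \<and> f (x \<oplus>\<^bsub>R\<^esub> y) = f x \<oplus>\<^bsub>E\<^esub> f y"
    "\<forall>r\<in>carrier R. \<forall>x\<in>I. r \<otimes>\<^bsub>R\<^esub> x \<in> I \<and> f (r \<otimes>\<^bsub>R\<^esub> x) = r \<odot>\<^bsub>E\<^esub> f x"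
    "f ` I \<subseteq> carrier E"
  shows "\<exists>c\<in>carrier E. \<forall>r\<in>I. f r = r \<odot>\<^bsub>E\<^esub> c"
  by (rule assms(1)[unfolded baer_def, rule_format, of I f]) (use assms(2-) in simp)

lemma lin_maps_comp:
  "f \<in> lin_maps R A B \<Longrightarrow> g \<in> lin_maps R B C \<Longrightarrow> (\<lambda>x. g (f x)) \<in> lin_maps R A C"
  by (auto simp: lin_maps_def Pi_def)

lemma injective_imp_baer:
  assumes E: "injective R E"
  shows "baer R E"
  unfolding baer_def
proof (intro allI impI, elim conjE)
  fix I f
  assume I: "I \<subseteq> carrier R" "I \<noteq> {}" 
    and add: "\<forall>x\<in>I. \<forall>y\<in>I. x \<oplus>\<^bsub>R\<^esub> y \<in> I \<and> f (x \<oplus>\<^bsub>R\<^esub> y) = f x \<oplus>\<^bsub>E\<^esub> f y"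
    and smul: "\<forall>r\<in>carrier R. \<forall>x\<in>I. r \<otimes>\<^bsub>R\<^esub> x \<in> I \<and> f (r \<otimes>\<^bsub>R\<^esub> x) = r \<odot>\<^bsub>E\<^esub> f x"
    and f: "f ` I \<subseteq> carrier E"
  interpret E: left_module R E using E by (simp add: injective_def)
  define \<rho> :: "'a \<Rightarrow> 'a univ" where "\<rho> = (\<lambda>r. {[Inl r]})"
  have inj: "inj_on \<rho> X" for X by (auto simp: \<rho>_def inj_on_def)
  have reg: "left_module R (regular R)" by (rule regular) (rule E.R.ring_axioms)
  have J: "left_module R (regular R\<lparr>carrier := I\<rparr>)" (is "left_module R ?J")
    by (rule left_module.restrict_left_module[OF reg]) (use I add smul in \<open>auto simp: regular_def\<close>)
  note tR = transport[OF reg inj]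
  note tI = transport[OF J inj]
  have inc: "(\<lambda>x. x) \<in> lin_maps R ?J (regular R)"
    using I by (auto simp: lin_maps_def regular_def)
  have fm: "f \<in> lin_maps R ?J E"
    using f add smul by (auto simp: lin_maps_def regular_def)
  have 1: "(\<lambda>x. \<rho> (inv_into (carrier ?J) \<rho> x)) \<in> lin_maps R (transport \<rho> ?J) (transport \<rho> (regular R))"
    using lin_maps_comp[OF tI(3) lin_maps_comp[OF inc tR(2)]] by simp
  have 2: "inj_on (\<lambda>x. \<rho> (inv_into (carrier ?J) \<rho> x)) (carrier (transport \<rho> ?J))"
    using inj tI(4) by (auto simp: inj_on_def inv_into_f_f[OF inj])
  obtain g where g: "g \<in> lin_maps R (transport \<rho> (regular R)) E" 
    and gf: "\<forall>x\<in>carrier (transport \<rho> ?J). g (\<rho> (inv_into (carrier ?J) \<rho> x)) = f (inv_into (carrier ?J) \<rho> x)"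
    using E tI(1) tR(1) 1 2 lin_maps_comp[OF tI(3) fm] unfolding injective_def by blast
  have gl: "(\<lambda>x. g (\<rho> x)) \<in> lin_maps R (regular R) E"
    using lin_maps_comp[OF tR(2) g] .
  show "\<exists>c\<in>carrier E. \<forall>r\<in>I. f r = r \<odot>\<^bsub>E\<^esub> c"
  proof (intro bexI[of _ "g (\<rho> \<one>\<^bsub>R\<^esub>)"] ballI)
    show "g (\<rho> \<one>\<^bsub>R\<^esub>) \<in> carrier E" using gl by (auto simp: lin_maps_def regular_def)
    fix r assume r: "r \<in> I"
    have "g (\<rho> r) = f r"
    proof -
      have "\<rho> r \<in> carrier (transport \<rho> ?J)" "inv_into (carrier ?J) \<rho> (\<rho> r) = r"
        using r tI(4) inv_into_f_f[OF inj, of r I] by simp_all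
      then show ?thesis using gf by metis
    qed
    moreover have "g (\<rho> (r \<otimes>\<^bsub>R\<^esub> \<one>\<^bsub>R\<^esub>)) = r \<odot>\<^bsub>E\<^esub> g (\<rho> \<one>\<^bsub>R\<^esub>)"
      using gl subsetD[OF I(1) r] E.R.one_closed by (auto simp del: E.R.r_one simp: lin_maps_def regular_def)
    moreover have "r \<otimes>\<^bsub>R\<^esub> \<one>\<^bsub>R\<^esub> = r" using r I by auto
    ultimately show "f r = r \<odot>\<^bsub>E\<^esub> g (\<rho> \<one>\<^bsub>R\<^esub>)" by simp
  qed
qed

lemma baer_extension:
  assumes E: "left_module R E" and baer: "baer R E"
    and A: "left_module R A" and B: "left_module R B" and i: "i \<in> lin_maps R A B"
    and inj: "inj_on i (carrier A)" and f: "f \<in> lin_maps R A E"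
  shows "\<exists>g\<in>lin_maps R B E. \<forall>x\<in>carrier A. g (i x) = f x"
proof -
  interpret E: left_module R E by fact
  interpret A: left_module R A by fact
  interpret B: left_module R B by fact
  define ok where "ok G \<longleftrightarrow> G \<subseteq> carrier B \<times> carrier E \<and>
     (\<forall>x y x' y'. (x, y) \<in> G \<and> (x', y') \<in> G \<longrightarrow> (x \<oplus>\<^bsub>B\<^esub> x', y \<oplus>\<^bsub>E\<^esub> y') \<in> G) \<and>
     (\<forall>r x y. r \<in> carrier R \<and> (x, y) \<in> G \<longrightarrow> (r \<odot>\<^bsub>B\<^esub> x, r \<odot>\<^bsub>E\<^esub> y) \<in> G) \<and>
     (\<forall>y. (\<zero>\<^bsub>B\<^esub>, y) \<in> G \<longrightarrow> y = \<zero>\<^bsub>E\<^esub>)" for G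
  define G0 where "G0 = (\<lambda>x. (i x, f x)) ` carrier A"
  have ic: "i x \<in> carrier B" and fc: "f x \<in> carrier E" if "x \<in> carrier A" for x
    using that i f by (auto simp: lin_maps_def)
  have i0: "i \<zero>\<^bsub>A\<^esub> = \<zero>\<^bsub>B\<^esub>" and f0: "f \<zero>\<^bsub>A\<^esub> = \<zero>\<^bsub>E\<^esub>"
  proof -
    have "i (\<zero>\<^bsub>R\<^esub> \<odot>\<^bsub>A\<^esub> \<zero>\<^bsub>A\<^esub>) = \<zero>\<^bsub>R\<^esub> \<odot>\<^bsub>B\<^esub> i \<zero>\<^bsub>A\<^esub>" using i by (simp add: lin_maps_def)
    then show "i \<zero>\<^bsub>A\<^esub> = \<zero>\<^bsub>B\<^esub>" by (simp add: A.smult_l_null B.smult_l_null ic)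
    have "f (\<zero>\<^bsub>R\<^esub> \<odot>\<^bsub>A\<^esub> \<zero>\<^bsub>A\<^esub>) = \<zero>\<^bsub>R\<^esub> \<odot>\<^bsub>E\<^esub> f \<zero>\<^bsub>A\<^esub>" using f by (simp add: lin_maps_def)
    then show "f \<zero>\<^bsub>A\<^esub> = \<zero>\<^bsub>E\<^esub>" by (simp add: A.smult_l_null E.smult_l_null fc)
  qed
  have ok0: "ok G0"
  proof -
    have "f x = \<zero>\<^bsub>E\<^esub>" if "x \<in> carrier A" "i x = \<zero>\<^bsub>B\<^esub>" for x
      using that inj_onD[OF inj, of x "\<zero>\<^bsub>A\<^esub>"] i0 f0 by auto
    moreover have "(i x \<oplus>\<^bsub>B\<^esub> i x', f x \<oplus>\<^bsub>E\<^esub> f x') \<in> G0" if "x \<in> carrier A" "x' \<in> carrier A" for x x'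
      using that i f unfolding G0_def by (intro image_eqI[of _ _ "x \<oplus>\<^bsub>A\<^esub> x'"]) (auto simp: lin_maps_def)
    moreover have "(r \<odot>\<^bsub>B\<^esub> i x, r \<odot>\<^bsub>E\<^esub> f x) \<in> G0" if "r \<in> carrier R" "x \<in> carrier A" for r x
      using that i f unfolding G0_def by (intro image_eqI[of _ _ "r \<odot>\<^bsub>A\<^esub> x"]) (auto simp: lin_maps_def)
    ultimately show ?thesis
      unfolding ok_def by (auto simp: G0_def ic fc)
  qed
  have "\<exists>G\<in>{G. ok G \<and> G0 \<subseteq> G}. \<forall>X\<in>{G. ok G \<and> G0 \<subseteq> G}. G \<subseteq> X \<longrightarrow> X = G"
  proof (rule subset_Zorn_nonempty)
    show "{G. ok G \<and> G0 \<subseteq> G} \<noteq> {}" using ok0 by blast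
    fix C assume ne: "C \<noteq> {}" and ch: "subset.chain {G. ok G \<and> G0 \<subseteq> G} C"
    have okC: "ok G" "G0 \<subseteq> G" if "G \<in> C" for G using ch that by (auto simp: subset.chain_def)
    have lin: "G \<subseteq> G' \<or> G' \<subseteq> G" if "G \<in> C" "G' \<in> C" for G G'
      using ch that unfolding subset.chain_def by blast
    have "ok (\<Union>C)"
      unfolding ok_def
    proof (intro conjI allI impI)
      show "\<Union>C \<subseteq> carrier B \<times> carrier E" using okC(1) unfolding ok_def by blast
      show "y = \<zero>\<^bsub>E\<^esub>" if "(\<zero>\<^bsub>B\<^esub>, y) \<in> \<Union>C" for y using that okC(1) unfolding ok_def by blast
      show "(r \<odot>\<^bsub>B\<^esub> x, r \<odot>\<^bsub>E\<^esub> y) \<in> \<Union>C" if "r \<in> carrier R \<and> (x, y) \<in> \<Union>C" for r x y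
        using that okC(1) unfolding ok_def by blast
      fix x y x' y' assume "(x, y) \<in> \<Union>C \<and> (x', y') \<in> \<Union>C"
      then obtain G G' where G: "G \<in> C" "(x, y) \<in> G" "G' \<in> C" "(x', y') \<in> G'" by blast
      then obtain H where "H \<in> C" "(x, y) \<in> H" "(x', y') \<in> H" using lin[of G G'] by blast
      then show "(x \<oplus>\<^bsub>B\<^esub> x', y \<oplus>\<^bsub>E\<^esub> y') \<in> \<Union>C"
        using okC(1)[of H] unfolding ok_def by blast
    qed
    then show "\<Union>C \<in> {G. ok G \<and> G0 \<subseteq> G}" using ne okC(2) by blast
  qed
  then obtain G where G: "G \<in> {G. ok G \<and> G0 \<subseteq> G}"
    and Gmax: "\<forall>X\<in>{G. ok G \<and> G0 \<subseteq> G}. G \<subseteq> X \<longrightarrow> X = G" by (rule bexE)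
  have okG: "ok G" and G0: "G0 \<subseteq> G" using G by simp_all
  have max: "X = G" if "ok X" "G \<subseteq> X" for X
    using Gmax that G0 by (simp add: order_trans[OF G0])
  have Gs: "x \<in> carrier B" "y \<in> carrier E" if "(x, y) \<in> G" for x y 
    using okG that by (auto simp: ok_def)
  have Ga: "(x \<oplus>\<^bsub>B\<^esub> x', y \<oplus>\<^bsub>E\<^esub> y') \<in> G" if "(x, y) \<in> G" "(x', y') \<in> G" for x y x' y'
    using okG that by (auto simp: ok_def)
  have Gm: "(r \<odot>\<^bsub>B\<^esub> x, r \<odot>\<^bsub>E\<^esub> y) \<in> G" if "r \<in> carrier R" "(x, y) \<in> G" for r x y
    using okG that by (auto simp: ok_def)
  have Gn: "(\<ominus>\<^bsub>B\<^esub> x, \<ominus>\<^bsub>E\<^esub> y) \<in> G" if "(x, y) \<in> G" for x y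
    using Gm[of "\<ominus>\<^bsub>R\<^esub> \<one>\<^bsub>R\<^esub>", OF _ that] Gs[OF that] by (simp add: B.smult_minus_one E.smult_minus_one)
  have Gz: "y = \<zero>\<^bsub>E\<^esub>" if "(\<zero>\<^bsub>B\<^esub>, y) \<in> G" for y
    using okG that by (auto simp: ok_def)
  have G00: "(\<zero>\<^bsub>B\<^esub>, \<zero>\<^bsub>E\<^esub>) \<in> G"
  proof -
    have "(i \<zero>\<^bsub>A\<^esub>, f \<zero>\<^bsub>A\<^esub>) \<in> G0" unfolding G0_def by (rule imageI) simp
    then show ?thesis using G0 i0 f0 by auto
  qed
  have uniq: "y = y'" if "(x, y) \<in> G" "(x, y') \<in> G" for x y y'
  proof -
    have "(x \<oplus>\<^bsub>B\<^esub> \<ominus>\<^bsub>B\<^esub> x, y \<oplus>\<^bsub>E\<^esub> \<ominus>\<^bsub>E\<^esub> y') \<in> G" using that by (intro Ga Gn)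
    then have "y \<oplus>\<^bsub>E\<^esub> \<ominus>\<^bsub>E\<^esub> y' = \<zero>\<^bsub>E\<^esub>" using Gz Gs[OF that(1)] by (simp add: B.M.r_neg)
    then show ?thesis using Gs[OF that(1)] Gs[OF that(2)] 
      by (metis E.M.minus_equality E.M.minus_minus E.M.a_inv_closed)
  qed
  have tot: "\<exists>c. (b, c) \<in> G" if b: "b \<in> carrier B" for b
  proof -
    define I where "I = {r \<in> carrier R. \<exists>y. (r \<odot>\<^bsub>B\<^esub> b, y) \<in> G}"
    define h where "h r = (THE y. (r \<odot>\<^bsub>B\<^esub> b, y) \<in> G)" for r
    have heq: "h r = y" if "(r \<odot>\<^bsub>B\<^esub> b, y) \<in> G" for r y
      unfolding h_def using that uniq by (intro the_equality) auto
    have hG: "(r \<odot>\<^bsub>B\<^esub> b, h r) \<in> G" if "r \<in> I" for r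
      using that heq by (auto simp: I_def)
    have IR: "r \<in> carrier R" if "r \<in> I" for r using that by (simp add: I_def)
    have addG: "((r \<oplus>\<^bsub>R\<^esub> s) \<odot>\<^bsub>B\<^esub> b, h r \<oplus>\<^bsub>E\<^esub> h s) \<in> G" if "r \<in> I" "s \<in> I" for r s
      using Ga[OF hG[OF that(1)] hG[OF that(2)]] IR that b by (simp add: B.smult_l_distr)
    have smG: "((t \<otimes>\<^bsub>R\<^esub> r) \<odot>\<^bsub>B\<^esub> b, t \<odot>\<^bsub>E\<^esub> h r) \<in> G" if "r \<in> I" "t \<in> carrier R" for r t
      using Gm[OF that(2) hG[OF that(1)]] IR that b by (simp add: B.smult_assoc1)
    have "\<exists>c\<in>carrier E. \<forall>r\<in>I. h r = r \<odot>\<^bsub>E\<^esub> c"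
    proof (rule baerD[OF baer])
      show "I \<subseteq> carrier R" using IR by blast
      have "\<zero>\<^bsub>R\<^esub> \<in> I" using G00 b by (auto simp: I_def B.smult_l_null)
      then show "I \<noteq> {}" by blast
      show "\<forall>x\<in>I. \<forall>y\<in>I. x \<oplus>\<^bsub>R\<^esub> y \<in> I \<and> h (x \<oplus>\<^bsub>R\<^esub> y) = h x \<oplus>\<^bsub>E\<^esub> h y"
        using addG heq IR unfolding I_def by blast
      show "\<forall>r\<in>carrier R. \<forall>x\<in>I. r \<otimes>\<^bsub>R\<^esub> x \<in> I \<and> h (r \<otimes>\<^bsub>R\<^esub> x) = r \<odot>\<^bsub>E\<^esub> h x"
        using smG heq IR unfolding I_def by blast
      show "h ` I \<subseteq> carrier E" using hG Gs by blast
    qed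
    then obtain c where c: "c \<in> carrier E" "\<And>r. r \<in> I \<Longrightarrow> h r = r \<odot>\<^bsub>E\<^esub> c"
      by blast
    have cG: "y = r \<odot>\<^bsub>E\<^esub> c" if "r \<in> carrier R" "(r \<odot>\<^bsub>B\<^esub> b, y) \<in> G" for r y
      using that heq c(2)[of r] by (auto simp: I_def)
    define G' where "G' = {(x \<oplus>\<^bsub>B\<^esub> r \<odot>\<^bsub>B\<^esub> b, y \<oplus>\<^bsub>E\<^esub> r \<odot>\<^bsub>E\<^esub> c) | x y r. (x, y) \<in> G \<and> r \<in> carrier R}"
    have G'I: "(u, v) \<in> G'" if "(x, y) \<in> G" "r \<in> carrier R" "u = x \<oplus>\<^bsub>B\<^esub> r \<odot>\<^bsub>B\<^esub> b" "v = y \<oplus>\<^bsub>E\<^esub> r \<odot>\<^bsub>E\<^esub> c" 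
      for u v x y r using that by (auto simp: G'_def)
    have G'E: "\<exists>u v r. (u, v) \<in> G \<and> r \<in> carrier R \<and> x = u \<oplus>\<^bsub>B\<^esub> r \<odot>\<^bsub>B\<^esub> b \<and> y = v \<oplus>\<^bsub>E\<^esub> r \<odot>\<^bsub>E\<^esub> c"
      if "(x, y) \<in> G'" for x y using that by (auto simp: G'_def)
    have "ok G'"
      unfolding ok_def
    proof (intro conjI allI impI)
      show "G' \<subseteq> carrier B \<times> carrier E" using Gs b c(1) by (auto simp: G'_def)
    next
      fix y assume "(\<zero>\<^bsub>B\<^esub>, y) \<in> G'"
      then obtain x z r where xz: "(x, z) \<in> G" "r \<in> carrier R" "\<zero>\<^bsub>B\<^esub> = x \<oplus>\<^bsub>B\<^esub> r \<odot>\<^bsub>B\<^esub> b"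
        "y = z \<oplus>\<^bsub>E\<^esub> r \<odot>\<^bsub>E\<^esub> c" by (auto simp: G'_def)
      have "\<ominus>\<^bsub>B\<^esub> x = r \<odot>\<^bsub>B\<^esub> b"
        using xz Gs[OF xz(1)] b B.M.minus_equality[of "r \<odot>\<^bsub>B\<^esub> b" x] by (simp add: B.M.a_comm)
      then have "\<ominus>\<^bsub>E\<^esub> z = r \<odot>\<^bsub>E\<^esub> c"
        using cG[OF xz(2)] Gn[OF xz(1)] by simp
      then show "y = \<zero>\<^bsub>E\<^esub>" using xz(4) Gs[OF xz(1)] by (metis E.M.r_neg)
    next
      fix x y x' y' assume "(x, y) \<in> G' \<and> (x', y') \<in> G'"
      then have "(x, y) \<in> G'" "(x', y') \<in> G'" by simp_all
      then obtain u v r u' v' r' where u: "(u, v) \<in> G" "r \<in> carrier R" "x = u \<oplus>\<^bsub>B\<^esub> r \<odot>\<^bsub>B\<^esub> b" 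
        "y = v \<oplus>\<^bsub>E\<^esub> r \<odot>\<^bsub>E\<^esub> c" "(u', v') \<in> G" "r' \<in> carrier R" "x' = u' \<oplus>\<^bsub>B\<^esub> r' \<odot>\<^bsub>B\<^esub> b" 
        "y' = v' \<oplus>\<^bsub>E\<^esub> r' \<odot>\<^bsub>E\<^esub> c" by (elim G'E[elim_format] exE conjE) (rule that)
      show "(x \<oplus>\<^bsub>B\<^esub> x', y \<oplus>\<^bsub>E\<^esub> y') \<in> G'"
        by (rule G'I[OF Ga[OF u(1,5)], of "r \<oplus>\<^bsub>R\<^esub> r'"])
          (use u Gs[OF u(1)] Gs[OF u(5)] b c(1) in \<open>simp_all add: B.smult_l_distr E.smult_l_distr
             B.add_exchange E.add_exchange\<close>)
    next
      fix t x y assume "t \<in> carrier R \<and> (x, y) \<in> G'"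
      then obtain u v r where u: "(u, v) \<in> G" "r \<in> carrier R" "x = u \<oplus>\<^bsub>B\<^esub> r \<odot>\<^bsub>B\<^esub> b" 
        "y = v \<oplus>\<^bsub>E\<^esub> r \<odot>\<^bsub>E\<^esub> c" and t: "t \<in> carrier R" by (auto simp: G'_def)
      show "(t \<odot>\<^bsub>B\<^esub> x, t \<odot>\<^bsub>E\<^esub> y) \<in> G'"
        by (rule G'I[OF Gm[OF t u(1)], of "t \<otimes>\<^bsub>R\<^esub> r"])
          (use u t Gs[OF u(1)] b c(1) in \<open>simp_all add: B.smult_r_distr E.smult_r_distr
             B.smult_assoc1 E.smult_assoc1\<close>)
    qed
    moreover have "G \<subseteq> G'"
    proof (rule subrelI)
      fix x y assume xy: "(x, y) \<in> G"
      show "(x, y) \<in> G'"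
        by (rule G'I[OF xy, of "\<zero>\<^bsub>R\<^esub>"]) (use Gs[OF xy] b c(1) in \<open>simp_all add: B.smult_l_null E.smult_l_null\<close>)
    qed
    ultimately have "G' = G" by (rule max)
    moreover have "(b, c) \<in> G'"
      by (rule G'I[OF G00, of "\<one>\<^bsub>R\<^esub>"]) (use b c(1) in simp_all)
    ultimately show ?thesis by blast
  qed
  define g where "g b = (THE c. (b, c) \<in> G)" for b
  have geq: "g b = c" if "(b, c) \<in> G" for b c
    unfolding g_def using that uniq by (intro the_equality) auto
  have gG: "(b, g b) \<in> G" if "b \<in> carrier B" for b using tot[OF that] geq by auto
  show ?thesis
  proof (intro bexI[of _ g] ballI)
    show "g \<in> lin_maps R B E"
      unfolding lin_maps_def
    proof (intro CollectI conjI ballI)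
      show "g \<in> carrier B \<rightarrow> carrier E" using Gs(2)[OF gG] by (rule Pi_I)
      show "g (x \<oplus>\<^bsub>B\<^esub> y) = g x \<oplus>\<^bsub>E\<^esub> g y" if "x \<in> carrier B" "y \<in> carrier B" for x y
        using that by (intro geq Ga gG)
      show "g (r \<odot>\<^bsub>B\<^esub> x) = r \<odot>\<^bsub>E\<^esub> g x" if "r \<in> carrier R" "x \<in> carrier B" for r x
        using that by (intro geq Gm gG)
    qed
    show "g (i x) = f x" if "x \<in> carrier A" for x
      using that G0 by (intro geq) (auto simp: G0_def)
  qed
qed

theorem injective_any_type:
  assumes "injective R E" "left_module R A" "left_module R B" "i \<in> lin_maps R A B"
    "inj_on i (carrier A)" "f \<in> lin_maps R A E"
  shows "\<exists>g\<in>lin_maps R B E. \<forall>x\<in>carrier A. g (i x) = f x"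
  using assms by (intro baer_extension injective_imp_baer) (auto simp: injective_def)

lemma baer_imp_injective: "left_module R E \<Longrightarrow> baer R E \<Longrightarrow> injective R E"
  unfolding injective_def by (auto intro: baer_extension)

lemma baer_transport:
  assumes M: "left_module R M" and inj: "inj_on \<rho> (carrier M)" and baer: "baer R M"
  shows "baer R (transport \<rho> M)"
  unfolding baer_def
proof (intro allI impI, elim conjE)
  let ?T = "transport \<rho> M" and ?\<iota> = "inv_into (carrier M) \<rho>"
  note T = transport[OF M inj]
  fix I f
  assume I: "I \<subseteq> carrier R" "I \<noteq> {}"
    and add: "\<forall>x\<in>I. \<forall>y\<in>I. x \<oplus>\<^bsub>R\<^esub> y \<in> I \<and> f (x \<oplus>\<^bsub>R\<^esub> y) = f x \<oplus>\<^bsub>?T\<^esub> f y"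
    and smul: "\<forall>r\<in>carrier R. \<forall>x\<in>I. r \<otimes>\<^bsub>R\<^esub> x \<in> I \<and> f (r \<otimes>\<^bsub>R\<^esub> x) = r \<odot>\<^bsub>?T\<^esub> f x"
    and f: "f ` I \<subseteq> carrier ?T"
  have fT: "f r \<in> carrier ?T" if "r \<in> I" for r using f that by blast
  have \<iota>: "?\<iota> \<in> carrier ?T \<rightarrow> carrier M"
    "\<And>x y. x \<in> carrier ?T \<Longrightarrow> y \<in> carrier ?T \<Longrightarrow> ?\<iota> (x \<oplus>\<^bsub>?T\<^esub> y) = ?\<iota> x \<oplus>\<^bsub>M\<^esub> ?\<iota> y"
    "\<And>r x. r \<in> carrier R \<Longrightarrow> x \<in> carrier ?T \<Longrightarrow> ?\<iota> (r \<odot>\<^bsub>?T\<^esub> x) = r \<odot>\<^bsub>M\<^esub> ?\<iota> x"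
    using T(3) unfolding lin_maps_def by blast+
  have "\<exists>c\<in>carrier M. \<forall>r\<in>I. ?\<iota> (f r) = r \<odot>\<^bsub>M\<^esub> c"
  proof (rule baerD[OF baer I])
    show "\<forall>x\<in>I. \<forall>y\<in>I. x \<oplus>\<^bsub>R\<^esub> y \<in> I \<and> ?\<iota> (f (x \<oplus>\<^bsub>R\<^esub> y)) = ?\<iota> (f x) \<oplus>\<^bsub>M\<^esub> ?\<iota> (f y)"
      using add by (simp add: \<iota>(2) fT)
    show "\<forall>r\<in>carrier R. \<forall>x\<in>I. r \<otimes>\<^bsub>R\<^esub> x \<in> I \<and> ?\<iota> (f (r \<otimes>\<^bsub>R\<^esub> x)) = r \<odot>\<^bsub>M\<^esub> ?\<iota> (f x)"
      using smul by (simp add: \<iota>(3) fT)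
    show "(\<lambda>r. ?\<iota> (f r)) ` I \<subseteq> carrier M"
      using fT \<iota>(1) by blast
  qed
  then obtain c where c: "c \<in> carrier M" "\<forall>r\<in>I. ?\<iota> (f r) = r \<odot>\<^bsub>M\<^esub> c" by blast
  show "\<exists>c\<in>carrier ?T. \<forall>r\<in>I. f r = r \<odot>\<^bsub>?T\<^esub> c"
  proof (intro bexI[of _ "\<rho> c"] ballI)
    show "\<rho> c \<in> carrier ?T" using T(4) c(1) by blast
    fix r assume r: "r \<in> I"
    have "f r = \<rho> (?\<iota> (f r))" using fT[OF r] unfolding T(4) by (rule f_inv_into_f[symmetric])
    also have "\<dots> = \<rho> (r \<odot>\<^bsub>M\<^esub> c)" using c(2) r by simp
    also have "\<dots> = r \<odot>\<^bsub>?T\<^esub> \<rho> c" using T(2) c(1) r I unfolding lin_maps_def by blast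
    finally show "f r = r \<odot>\<^bsub>?T\<^esub> \<rho> c" .
  qed
qed

text \<open>Every element of an injective module lies in an injective submodule that is the image of the
  following type of trees, hence embeds into the type \<open>'r univ\<close>.\<close>

datatype 'r tree = Gen | TAdd "'r tree" "'r tree" | TScal 'r "'r tree" | TExt "'r \<Rightarrow> 'r tree option"

primrec tree_code :: "'r tree \<Rightarrow> 'r univ" where
  "tree_code Gen = {[Inr 0]}"
| "tree_code (TAdd t u) = {[Inr 1]} \<union> Cons (Inr 2) ` tree_code t \<union> Cons (Inr 3) ` tree_code u"
| "tree_code (TScal r t) = {[Inr 4], [Inr 5, Inl r]} \<union> Cons (Inr 6) ` tree_code t"
| "tree_code (TExt f) = {[Inr 7]} \<union>
     {Inr 8 # Inl r # w | r w. \<exists>c. map_option tree_code (f r) = Some c \<and> w \<in> c}"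

lemma tree_code_inj: "tree_code t = tree_code u \<Longrightarrow> t = u"
proof (induction t arbitrary: u)
  case Gen
  then show ?case by (cases u) auto
next
  case (TAdd t1 t2)
  have "[Inr 1] \<in> tree_code u" using TAdd.prems by auto
  then obtain u1 u2 where u: "u = TAdd u1 u2" by (cases u) auto
  have 1: "tree_code a = {w. Inr 2 # w \<in> tree_code (TAdd a b)}"
    and 2: "tree_code b = {w. Inr 3 # w \<in> tree_code (TAdd a b)}" for a b :: "'a tree" by auto
  have "tree_code t1 = tree_code u1" "tree_code t2 = tree_code u2"
    unfolding 1[of t1 t2] 1[of u1 u2] 2[of t2 t1] 2[of u2 u1] TAdd.prems u by (rule refl)+
  then show ?case using TAdd.IH u by simp
next
  case (TScal r t)
  have "[Inr 4] \<in> tree_code u" using TScal.prems by auto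
  then obtain r' t' where u: "u = TScal r' t'" by (cases u) auto
  have 1: "tree_code a = {w. Inr 6 # w \<in> tree_code (TScal p a)}"
    and 2: "{p} = {x. [Inr 5, Inl x] \<in> tree_code (TScal p a)}" for p and a :: "'a tree" by auto
  have "tree_code t = tree_code t'" "{r} = {r'}"
    unfolding 1[of t r] 1[of t' r'] 2[of r t] 2[of r' t'] TScal.prems u by (rule refl)+
  then show ?case using TScal.IH u by simp
next
  case (TExt f)
  have "[Inr 7] \<in> tree_code u" using TExt.prems by auto
  then obtain g where u: "u = TExt g" by (cases u) auto
  have ne: "tree_code t \<noteq> {}" for t :: "'a tree" by (cases t) auto
  have eq: "{w. Inr 8 # Inl r # w \<in> tree_code (TExt h)} = 
     (case h r of None \<Rightarrow> {} | Some t \<Rightarrow> tree_code t)" for r :: 'a and h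
    by (auto split: option.splits)
  have "f r = g r" for r
  proof -
    have *: "(case f r of None \<Rightarrow> {} | Some t \<Rightarrow> tree_code t) = 
       (case g r of None \<Rightarrow> {} | Some t \<Rightarrow> tree_code t)"
      using TExt.prems unfolding u eq[symmetric] by simp
    show ?thesis
    proof (cases "f r")
      case None
      then show ?thesis using * ne by (cases "g r") (auto dest: sym)
    next
      case (Some t)
      then obtain t' where "g r = Some t'" "tree_code t = tree_code t'" 
        using * ne by (cases "g r") auto
      then show ?thesis using TExt.IH[OF rangeI[of f r], of t t'] Some by simp
    qed
  qed
  then show ?case unfolding u by auto
qed

definition pick :: "'e set \<Rightarrow> 'e \<Rightarrow> ('e \<Rightarrow> bool) \<Rightarrow> 'e" where
  "pick A e P = (if \<exists>c\<in>A. P c then SOME c. c \<in> A \<and> P c else e)"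

lemma pick: "\<exists>c\<in>A. P c \<Longrightarrow> P (pick A e P)"
  unfolding pick_def by (simp, rule someI2_ex[of "\<lambda>c. c \<in> A \<and> P c"]) auto

lemma pick_in: "e \<in> A \<Longrightarrow> pick A e P \<in> A"
  unfolding pick_def by (simp, rule impI, rule someI2_ex[of "\<lambda>c. c \<in> A \<and> P c"]) auto

primrec tree_val :: "('r, 'x) ring_scheme \<Rightarrow> ('r, 'e) module \<Rightarrow> 'e \<Rightarrow> 'r tree \<Rightarrow> 'e" where
  "tree_val R E e Gen = e"
| "tree_val R E e (TAdd t u) = tree_val R E e t \<oplus>\<^bsub>E\<^esub> tree_val R E e u"
| "tree_val R E e (TScal r t) = (if r \<in> carrier R then r \<odot>\<^bsub>E\<^esub> tree_val R E e t else e)"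
| "tree_val R E e (TExt f) =
    pick (carrier E) e (\<lambda>c. \<forall>r v. map_option (tree_val R E e) (f r) = Some v \<longrightarrow> v = r \<odot>\<^bsub>E\<^esub> c)"

theorem high_any_type:
  assumes \<phi>: "high R \<phi>" and E: "injective R E"
  shows "pp_set \<phi> E = carrier E"
proof
  show "pp_set \<phi> E \<subseteq> carrier E" by (cases \<phi>) auto
  interpret E: left_module R E using E by (simp add: injective_def)
  show "carrier E \<subseteq> pp_set \<phi> E"
  proof
    fix e assume e: "e \<in> carrier E"
    define v where "v = tree_val R E e"
    define H where "H = range v"
    have vE: "v t \<in> carrier E" for t
    proof (induction t)
      case (TExt f)
      show ?case unfolding v_def tree_val.simps using e by (rule pick_in)
    qed (use e in \<open>auto simp: v_def\<close>)
    have H: "H \<subseteq> carrier E" using vE by (auto simp: H_def)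
    have Ha: "x \<oplus>\<^bsub>E\<^esub> y \<in> H" if xy: "x \<in> H" "y \<in> H" for x y
    proof -
      obtain t u where "x = v t" "y = v u" using xy unfolding H_def by blast
      then have "x \<oplus>\<^bsub>E\<^esub> y = v (TAdd t u)" by (simp add: v_def)
      then show ?thesis by (simp add: H_def)
    qed
    have Hs: "r \<odot>\<^bsub>E\<^esub> x \<in> H" if rx: "r \<in> carrier R" "x \<in> H" for r x
    proof -
      obtain t where "x = v t" using rx unfolding H_def by blast
      then have "r \<odot>\<^bsub>E\<^esub> x = v (TScal r t)" using rx by (simp add: v_def)
      then show ?thesis by (simp add: H_def)
    qed
    have eH: "e \<in> H" unfolding H_def by (rule range_eqI[of _ _ Gen]) (simp add: v_def)
    let ?E = "E\<lparr>carrier := H\<rparr>"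
    have mod: "left_module R ?E"
      using H eH Ha Hs by (intro E.restrict_left_module) auto
    have "baer R ?E"
      unfolding baer_def
    proof (intro allI impI, elim conjE)
      fix I f
      assume I: "I \<subseteq> carrier R" "I \<noteq> {}" 
        and add: "\<forall>x\<in>I. \<forall>y\<in>I. x \<oplus>\<^bsub>R\<^esub> y \<in> I \<and> f (x \<oplus>\<^bsub>R\<^esub> y) = f x \<oplus>\<^bsub>?E\<^esub> f y"
        and smul: "\<forall>r\<in>carrier R. \<forall>x\<in>I. r \<otimes>\<^bsub>R\<^esub> x \<in> I \<and> f (r \<otimes>\<^bsub>R\<^esub> x) = r \<odot>\<^bsub>?E\<^esub> f x"
        and f: "f ` I \<subseteq> carrier ?E"
      have fH: "f ` I \<subseteq> H" using f by simp
      have 1: "\<exists>c\<in>carrier E. \<forall>r\<in>I. f r = r \<odot>\<^bsub>E\<^esub> c"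
        by (rule baerD[OF injective_imp_baer[OF E]]) (use I add smul fH H in auto)
      define p where "p r = (if r \<in> I then Some (SOME t. v t = f r) else None)" for r
      have p: "map_option v (p r) = (if r \<in> I then Some (f r) else None)" for r
      proof -
        have "\<exists>t. v t = f r" if "r \<in> I"
        proof -
          have "f r \<in> range v" using that fH unfolding H_def by (rule image_subset_iff[THEN iffD1, rule_format, rotated])
          then obtain t where "f r = v t" by (rule rangeE)
          then show ?thesis by (intro exI[of _ t]) (rule sym)
        qed
        then have "r \<in> I \<Longrightarrow> v (SOME t. v t = f r) = f r" by (rule someI_ex)
        then show ?thesis by (simp add: p_def)
      qed
      have P: "(\<forall>r y. map_option v (p r) = Some y \<longrightarrow> y = r \<odot>\<^bsub>E\<^esub> c) \<longleftrightarrow> (\<forall>r\<in>I. f r = r \<odot>\<^bsub>E\<^esub> c)" for c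
        by (auto simp: p split: if_splits)
      have "\<forall>r\<in>I. f r = r \<odot>\<^bsub>E\<^esub> v (TExt p)"
        unfolding v_def tree_val.simps unfolding v_def[symmetric] P using 1 by (rule pick)
      then show "\<exists>c\<in>carrier ?E. \<forall>r\<in>I. f r = r \<odot>\<^bsub>?E\<^esub> c"
        by (auto simp: H_def)
    qed
    then have injH: "baer R ?E" .
    define \<rho> where "\<rho> x = tree_code (SOME t. v t = x)" for x
    have inj: "inj_on \<rho> (carrier ?E)"
    proof (rule inj_onI)
      fix x y assume xy: "x \<in> carrier ?E" "y \<in> carrier ?E" "\<rho> x = \<rho> y"
      have sel: "v (SOME t. v t = z) = z" if "z \<in> H" for z
        using that unfolding H_def by (metis (mono_tags, lifting) imageE someI_ex)
      then show "x = y" using sel[of x] sel[of y] xy(1,2) tree_code_inj[OF xy(3)[unfolded \<rho>_def]] by simp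
    qed
    note T = transport[OF mod inj]
    let ?T = "transport \<rho> ?E"
    have "injective R ?T"
      by (rule baer_imp_injective[OF T(1) baer_transport[OF mod inj injH]])
    then have "pp_set \<phi> ?T = carrier ?T" using \<phi> by (simp add: high_def)
    then have "\<rho> e \<in> pp_set \<phi> ?T" using eH T(4) by simp
    moreover have "inv_into (carrier ?E) \<rho> \<in> lin_maps R ?T E"
      using T(3) H by (auto simp: lin_maps_def Pi_def)
    ultimately have "inv_into (carrier ?E) \<rho> (\<rho> e) \<in> pp_set \<phi> E"
      using \<phi> by (intro pp_set_lin_map[OF T(1) E.left_module_axioms]) (auto simp: high_def)
    then show "e \<in> pp_set \<phi> E" using inv_into_f_f[OF inj, of e] eH by simp
  qed
qed

end

(* If a pp formula phi, EX y. Ay = bx, and finitely many pp formulas psi are high, then so is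
   EX y. Ay = bx & (ALL j psi. psi(y_j)). Hence every x in the first Ulm submodule u satisfies it, and
   in a sufficiently saturated module compactness gives a solution y with entries in u; that is, u is
   its own first Ulm submodule. Full saturation is not needed: it is enough that the module is the
   union of an elementary chain of length omega in which each step realises the finitely satisfiable
   systems over the previous one, and such a chain is obtained by iterating an ultrapower whose
   index set is the set of finite sets of pp formulas. The union of the chain is realised directly,
   as the classes of functions of an omega-sequence of indices that depend on finitely many of them. *)

theory Submission
  imports Defs "HOL-Library.Countable_Set"
begin

section \<open>Ultrafilters\<close>

text \<open>The obstacle is that the Ulm submodule is an infinite intersection, so Los's theorem
  does not apply to it directly: one solution y must satisfy all high formulas at once. Using a set
  F of formulas as index, one would like to choose y(s) good for F = s. In a single ultrapower this
  fails for new elements: for each F the condition on f(s) holds for almost all s, but nothing puts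
  the index s itself into the set that belongs to F = s. A fresh coordinate that f does not see
  removes the difficulty, because F is then fixed before the quantifiers over the coordinates of f
  are evaluated. This is why the newest coordinate is quantified outermost, and why y needs exactly
  one coordinate more than f. Every element uses finitely many coordinates, so omega of them
  suffice. Each index is almost surely a finite set, since only finitely many high formulas combine
  into one, and it almost surely contains any given formula.\<close>

definition ultra :: "'a filter \<Rightarrow> bool" where
  "ultra V \<longleftrightarrow> V \<noteq> bot \<and> (\<forall>P. eventually P V \<or> eventually (\<lambda>x. \<not> P x) V)"

lemma ex_ultra_le:
  assumes "F \<noteq> bot"
  obtains V where "V \<le> F" "ultra V"
proof -
  define A where "A = {G. G \<noteq> bot \<and> G \<le> F}"
  \<comment> \<open>Finer filters are smaller, so Zorn's lemma is applied to the reversed order: the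
    upper bound of a nonempty chain is its infimum, which stays proper.\<close>
  have "\<exists>m\<in>A. \<forall>a\<in>A. a \<le> m \<longrightarrow> a = m"
  proof (rule predicate_Zorn)
    show "partial_order_on A (relation_of (\<lambda>G H. H \<le> G) A)"
      by (rule partial_order_on_relation_ofI) auto
    fix C assume "C \<in> Chains (relation_of (\<lambda>G H. H \<le> G) A)"
    then have C: "C \<subseteq> A" and lin: "\<And>G H. G \<in> C \<Longrightarrow> H \<in> C \<Longrightarrow> G \<le> H \<or> H \<le> G"
      by (auto simp: Chains_def relation_of_def)
    show "\<exists>u\<in>A. \<forall>a\<in>C. u \<le> a"
    proof (cases "C = {}")
      case True
      then show ?thesis using assms by (auto simp: A_def)
    next
      case False
      have "eventually P (Inf C) \<longleftrightarrow> (\<exists>G\<in>C. eventually P G)" for P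
      proof (rule eventually_Inf_base[OF False])
        fix G H assume "G \<in> C" "H \<in> C"
        then show "\<exists>x\<in>C. x \<le> inf G H" using lin[of G H] by (auto intro: bexI[of _ G] bexI[of _ H])
      qed
      then have "Inf C \<noteq> bot"
        using C by (auto simp: A_def trivial_limit_def)
      moreover have "Inf C \<le> F"
        using False C by (auto simp: A_def intro: Inf_lower2)
      ultimately show ?thesis by (auto simp: A_def intro: Inf_lower)
    qed
  qed
  then obtain V where V: "V \<noteq> bot" "V \<le> F"
    and min: "\<And>G. G \<noteq> bot \<Longrightarrow> G \<le> V \<Longrightarrow> G = V"
    unfolding A_def by (blast intro: order_trans)
  \<comment> \<open>If the complement of \<open>P\<close> is not in \<open>V\<close>, adjoining
    \<open>P\<close> leaves the filter proper, so by minimality it was already there.\<close>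
  have "eventually P V" if "\<not> eventually (\<lambda>x. \<not> P x) V" for P
  proof -
    have "inf V (principal {x. P x}) \<noteq> bot"
      using that by (simp add: trivial_limit_def eventually_inf_principal)
    then have "inf V (principal {x. P x}) = V" by (intro min) auto
    moreover have "eventually P (inf V (principal {x. P x}))" by (simp add: eventually_inf_principal)
    ultimately show ?thesis by simp
  qed
  then have "ultra V" using V by (auto simp: ultra_def)
  with V that show ?thesis by blast
qed

lemma ultra_const [simp]: "ultra V \<Longrightarrow> eventually (\<lambda>_. P) V \<longleftrightarrow> P"
  by (auto simp: ultra_def trivial_limit_def)

lemma ultra_not: "ultra V \<Longrightarrow> eventually (\<lambda>x. \<not> P x) V \<longleftrightarrow> \<not> eventually P V"
proof -
  assume V: "ultra V"
  then have "\<not> (eventually P V \<and> eventually (\<lambda>x. \<not> P x) V)"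
    unfolding eventually_conj_iff[symmetric] by simp
  with V show ?thesis unfolding ultra_def by blast
qed

section \<open>Iterated ultrafilter quantifiers\<close>

primrec iter_ev :: "'a filter \<Rightarrow> nat \<Rightarrow> ((nat \<Rightarrow> 'a) \<Rightarrow> bool) \<Rightarrow> (nat \<Rightarrow> 'a) \<Rightarrow> bool" where
  "iter_ev U 0 P s \<longleftrightarrow> P s"
| "iter_ev U (Suc k) P s \<longleftrightarrow> eventually (\<lambda>x. iter_ev U k P (s(k := x))) U"

definition depends_below :: "nat \<Rightarrow> ((nat \<Rightarrow> 'a) \<Rightarrow> 'b) \<Rightarrow> bool" where
  "depends_below k f \<longleftrightarrow> (\<forall>s t. (\<forall>i<k. s i = t i) \<longrightarrow> f s = f t)"

lemma depends_below_mono: "depends_below k f \<Longrightarrow> k \<le> l \<Longrightarrow> depends_below l f"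
  by (force simp: depends_below_def)

lemma iter_ev_conj: "iter_ev U k (\<lambda>s. P s \<and> P' s) s \<longleftrightarrow> iter_ev U k P s \<and> iter_ev U k P' s"
  by (induction k arbitrary: s) (auto simp: eventually_conj_iff)

lemma iter_ev_mono: "iter_ev U k P s \<Longrightarrow> (\<And>s. P s \<Longrightarrow> P' s) \<Longrightarrow> iter_ev U k P' s"
  by (induction k arbitrary: s) (auto elim!: eventually_mono)

lemma iter_ev_const: "ultra U \<Longrightarrow> iter_ev U k (\<lambda>_. c) s \<longleftrightarrow> c"
  by (induction k arbitrary: s) auto

lemma iter_ev_not: "ultra U \<Longrightarrow> iter_ev U k (\<lambda>s. \<not> P s) s \<longleftrightarrow> \<not> iter_ev U k P s"
  by (induction k arbitrary: s) (auto simp: ultra_not)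

text \<open>Coordinates below \<open>j\<close> are overwritten by the quantifiers and those from
  \<open>k\<close> on are invisible to \<open>P\<close>; only the ones in between are read from
  \<open>s\<close>. For \<open>j = k\<close> the seed is therefore irrelevant.\<close>

lemma iter_ev_below:
  assumes "depends_below k P" "j \<le> k" "\<And>i. j \<le> i \<Longrightarrow> i < k \<Longrightarrow> s i = t i"
  shows "iter_ev U j P s \<longleftrightarrow> iter_ev U j P t"
  using assms(2,3)
proof (induction j arbitrary: s t)
  case 0
  then show ?case using assms(1) by (auto simp: depends_below_def)
next
  case (Suc j)
  have "iter_ev U j P (s(j := x)) \<longleftrightarrow> iter_ev U j P (t(j := x))" for x
    using Suc.prems by (intro Suc.IH) auto
  then show ?case by simp
qed

text \<open>A quantifier over a coordinate that \<open>P\<close> does not see is vacuous. Truth is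
  thus constant from \<open>k\<close> on, which lets a limit over \<open>n\<close> decide every
  predicate of finitely many coordinates.\<close>

lemma iter_ev_stable:
  assumes "ultra U" "depends_below k P" "k \<le> n"
  shows "iter_ev U n P s \<longleftrightarrow> iter_ev U k P s"
  using assms(3)
proof (induction n rule: dec_induct)
  case (step n)
  have "depends_below n P" using assms(2) step.hyps by (auto intro: depends_below_mono)
  then have "iter_ev U n P (s(n := x)) \<longleftrightarrow> iter_ev U n P s" for x
    by (rule iter_ev_below) auto
  then show ?case using step.IH assms(1) by simp
qed simp

text \<open>The outermost quantifier fixes the value \<open>x\<close> of coordinate
  \<open>k\<close>. Almost every \<open>x\<close> is finite and contains \<open>p\<close>, and for
  such an \<open>x\<close> the inner quantifiers only face the predicate \<open>P x\<close>, to
  which the hypothesis applies.\<close>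

lemma iter_ev_diagonal:
  fixes U :: "'a set filter"
  assumes "\<And>x. depends_below k (P x)"
    and "\<And>x. finite x \<Longrightarrow> iter_ev U k (P x) s" and "U \<le> finite_subsets_at_top UNIV"
  shows "iter_ev U (Suc k) (\<lambda>s. P (s k) s \<and> p \<in> s k) s"
proof -
  \<comment> \<open>The inner quantifiers change only coordinates below \<open>k\<close>, so
    \<open>s k\<close> may be frozen to its current value.\<close>
  have *: "iter_ev U j (\<lambda>s. P (s k) s \<and> p \<in> s k) t \<longleftrightarrow> iter_ev U j (\<lambda>s. P (t k) s \<and> p \<in> t k) t"
    if "j \<le> k" for j t
    using that
  proof (induction j arbitrary: t)
    case (Suc j)
    then have "(t(j := x)) k = t k" for x by simp
    moreover from Suc have "iter_ev U j (\<lambda>s. P (s k) s \<and> p \<in> s k) (t(j := x))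
      \<longleftrightarrow> iter_ev U j (\<lambda>s. P ((t(j := x)) k) s \<and> p \<in> (t(j := x)) k) (t(j := x))" for x by simp
    ultimately show ?case by simp
  qed simp
  have "eventually (\<lambda>x. finite x \<and> p \<in> x) (finite_subsets_at_top UNIV)"
    unfolding eventually_finite_subsets_at_top by (intro exI[of _ "{p}"]) auto
  then have ev: "eventually (\<lambda>x. finite x \<and> p \<in> x) U" using assms(3) by (rule filter_leD[rotated])
  have "iter_ev U k (\<lambda>s. P (s k) s \<and> p \<in> s k) (s(k := x))" if "finite x" "p \<in> x" for x
  proof -
    have "iter_ev U k (P x) (s(k := x)) \<longleftrightarrow> iter_ev U k (P x) s"
      using assms(1) by (intro iter_ev_below) auto
    then show ?thesis using assms(2)[OF that(1)] that(2) by (simp add: *)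
  qed
  then show ?thesis using ev by (auto elim!: eventually_mono)
qed

text \<open>The ultrafilter behind an \<open>\<omega>\<close>-fold iterated ultrapower: the coordinate \<open>k\<close> is generic over the
  coordinates below \<open>k\<close>.\<close>

definition diagonal_ultra :: "(nat \<Rightarrow> 'a set) filter \<Rightarrow> bool" where
  "diagonal_ultra V \<longleftrightarrow> ultra V \<and> (\<forall>k P p. (\<forall>F. depends_below k (P F)) \<longrightarrow>
     (\<forall>F. finite F \<longrightarrow> eventually (P F) V) \<longrightarrow> eventually (\<lambda>s. P (s k) s \<and> p \<in> s k) V)"

lemma diagonal_ultraD:
  assumes "diagonal_ultra V" "\<And>F. depends_below k (P F)" "\<And>F. finite F \<Longrightarrow> eventually (P F) V"
  shows "eventually (\<lambda>s. P (s k) s \<and> p \<in> s k) V"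
  using assms(1)[unfolded diagonal_ultra_def, THEN conjunct2, rule_format, of k P p] assms(2,3) by simp

lemma ex_diagonal_ultra: "\<exists>V :: (nat \<Rightarrow> 'a set) filter. diagonal_ultra V"
proof -
  obtain U :: "'a set filter" where U: "U \<le> finite_subsets_at_top UNIV" "ultra U"
    using ex_ultra_le[OF finite_subsets_at_top_neq_bot] by blast
  \<comment> \<open>This is a filter but in general not an ultrafilter: for a predicate of
    infinitely many coordinates the truth values may oscillate with \<open>k\<close>. Hence it is
    extended to \<open>V\<close> afterwards.\<close>
  define lim where "lim P \<longleftrightarrow> eventually (\<lambda>k. iter_ev U k P (\<lambda>_. {})) sequentially" for P
  have "is_filter lim"
    unfolding lim_def
    by standard (auto simp: iter_ev_const[OF U(2)] iter_ev_conj eventually_conj_iff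
        elim!: eventually_mono intro: iter_ev_mono)
  then have ev: "eventually P (Abs_filter lim) \<longleftrightarrow> lim P" for P
    by (rule eventually_Abs_filter)
  have "Abs_filter lim \<noteq> bot"
    unfolding trivial_limit_def ev by (simp add: lim_def iter_ev_const[OF U(2)])
  then obtain V where V: "V \<le> Abs_filter lim" "ultra V" by (rule ex_ultra_le)
  have intro: "eventually P V" if "depends_below k P" "iter_ev U k P (\<lambda>_. {})" for k P
  proof (rule filter_leD[OF V(1)])
    show "eventually P (Abs_filter lim)"
      unfolding ev lim_def eventually_sequentially
      using that iter_ev_stable[OF U(2) that(1), THEN iffD2] by blast
  qed
  \<comment> \<open>On predicates of finitely many coordinates the extension made no choice: if the
    iterated quantifier failed, it would hold for the negation, and \<open>V\<close> would contain
    both.\<close>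
  have elim: "iter_ev U k P (\<lambda>_. {})" if "depends_below k P" "eventually P V" for k P
  proof (rule ccontr)
    assume "\<not> ?thesis"
    moreover have "depends_below k (\<lambda>s. \<not> P s)" using that(1) unfolding depends_below_def by blast
    ultimately have "eventually (\<lambda>s. \<not> P s) V" by (intro intro) (auto simp: iter_ev_not[OF U(2)])
    then show False using that(2) V(2) by (simp add: ultra_not)
  qed
  have "diagonal_ultra V"
    unfolding diagonal_ultra_def
  proof (intro conjI allI impI V(2))
    fix k and P :: "'a set \<Rightarrow> (nat \<Rightarrow> 'a set) \<Rightarrow> bool" and p :: 'a
    assume dep: "\<forall>F. depends_below k (P F)" and "\<forall>F. finite F \<longrightarrow> eventually (P F) V"
    then have "iter_ev U (Suc k) (\<lambda>s. P (s k) s \<and> p \<in> s k) (\<lambda>_. {})"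
      by (intro iter_ev_diagonal U(1) elim) auto
    moreover have "depends_below (Suc k) (\<lambda>s. P (s k) s \<and> p \<in> s k)"
      unfolding depends_below_def
    proof (intro allI impI)
      fix s t :: "nat \<Rightarrow> 'a set" assume st: "\<forall>i<Suc k. s i = t i"
      then have "P (s k) s = P (s k) t" using dep by (simp add: depends_below_def)
      with st show "(P (s k) s \<and> p \<in> s k) = (P (t k) t \<and> p \<in> t k)" by simp
    qed
    ultimately show "eventually (\<lambda>s. P (s k) s \<and> p \<in> s k) V" by (rule intro[rotated])
  qed
  then show ?thesis ..
qed

section \<open>The extension of a module by definable sequences\<close>

lemma lin_maps_zero:
  assumes "left_module R M" "left_module R N" "f \<in> lin_maps R M N"
  shows "f \<zero>\<^bsub>M\<^esub> = \<zero>\<^bsub>N\<^esub>"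
proof -
  interpret M: left_module R M by fact
  interpret N: left_module R N by fact
  have "f (\<zero>\<^bsub>R\<^esub> \<odot>\<^bsub>M\<^esub> \<zero>\<^bsub>M\<^esub>) = \<zero>\<^bsub>R\<^esub> \<odot>\<^bsub>N\<^esub> f \<zero>\<^bsub>M\<^esub>" "f \<zero>\<^bsub>M\<^esub> \<in> carrier N"
    using assms(3) by (auto simp: lin_maps_def)
  then show ?thesis by (simp add: M.smult_l_null N.smult_l_null)
qed

lemma lin_maps_neg:
  assumes "left_module R M" "left_module R N" "f \<in> lin_maps R M N" "x \<in> carrier M"
  shows "f (\<ominus>\<^bsub>M\<^esub> x) = \<ominus>\<^bsub>N\<^esub> f x"
proof -
  interpret M: left_module R M by fact
  interpret N: left_module R N by fact
  have "f ((\<ominus>\<^bsub>R\<^esub> \<one>\<^bsub>R\<^esub>) \<odot>\<^bsub>M\<^esub> x) = (\<ominus>\<^bsub>R\<^esub> \<one>\<^bsub>R\<^esub>) \<odot>\<^bsub>N\<^esub> f x" "f x \<in> carrier N"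
    using assms(3,4) by (auto simp: lin_maps_def)
  then show ?thesis using assms(4) by (simp add: M.smult_minus_one N.smult_minus_one)
qed

lemma finite_tvars [simp]: "finite (tvars t)"
  by (induction t) auto

lemma finite_fvars [simp]: "finite (fvars \<phi>)"
  by (induction \<phi>) auto

lemma tval_cong: "(\<And>v. v \<in> tvars t \<Longrightarrow> s v = s' v) \<Longrightarrow> tval M s t = tval M s' t"
  by (induction t) auto

lemma sat_cong: "(\<And>v. v \<in> fvars \<phi> \<Longrightarrow> s v = s' v) \<Longrightarrow> sat M s \<phi> \<longleftrightarrow> sat M s' \<phi>"
proof (induction \<phi> arbitrary: s s')
  case (FEq t u)
  then have "tval M s t = tval M s' t" "tval M s u = tval M s' u" by (auto intro!: tval_cong)
  then show ?case by simp
next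
  case (FNot \<phi>)
  have "sat M s \<phi> = sat M s' \<phi>" by (rule FNot.IH) (use FNot.prems in auto)
  then show ?case by simp
next
  case (FAnd \<phi> \<psi>)
  have "sat M s \<phi> = sat M s' \<phi>" by (rule FAnd.IH) (use FAnd.prems in auto)
  moreover have "sat M s \<psi> = sat M s' \<psi>" by (rule FAnd.IH) (use FAnd.prems in auto)
  ultimately show ?case by simp
next
  case (FEx v \<phi>)
  have "sat M (s(v := x)) \<phi> = sat M (s'(v := x)) \<phi>" for x
    by (rule FEx.IH) (use FEx.prems in auto)
  then show ?case by simp
qed

lemma tval_closed:
  assumes "left_module R M" "set_mterm t \<subseteq> carrier R" "range s \<subseteq> carrier M"
  shows "tval M s t \<in> carrier M"
proof -
  interpret left_module R M by fact
  show ?thesis using assms(2,3) by (induction t) auto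
qed

lemma tval_lin_map:
  assumes "left_module R M" "left_module R N" "h \<in> lin_maps R M N"
    and "set_mterm t \<subseteq> carrier R" "range s \<subseteq> carrier M"
  shows "tval N (\<lambda>v. h (s v)) t = h (tval M s t)"
  using assms(4)
proof (induction t)
  case Zero
  then show ?case by (simp add: lin_maps_zero[OF assms(1-3)])
next
  case (Neg t)
  then show ?case using tval_closed[OF assms(1) _ assms(5), of t] by (simp add: lin_maps_neg[OF assms(1-3)])
next
  case (Add t u)
  then show ?case using tval_closed[OF assms(1) _ assms(5)] assms(3) by (simp add: lin_maps_def)
next
  case (Scal r t)
  then show ?case using tval_closed[OF assms(1) _ assms(5), of t] assms(3) by (simp add: lin_maps_def)
qed simp

lemma sat_iso:
  assumes "left_module R M" "left_module R N" "h \<in> lin_maps R M N" "bij_betw h (carrier M) (carrier N)"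
    and "set_mform \<phi> \<subseteq> carrier R" "range s \<subseteq> carrier M"
  shows "sat N (\<lambda>v. h (s v)) \<phi> \<longleftrightarrow> sat M s \<phi>"
  using assms(5,6)
proof (induction \<phi> arbitrary: s)
  case (FEq t u)
  then have "set_mterm t \<subseteq> carrier R" "set_mterm u \<subseteq> carrier R" by auto
  then show ?case
    using tval_closed[OF assms(1) _ FEq(2)] bij_betw_imp_inj_on[OF assms(4)]
    by (simp add: tval_lin_map[OF assms(1-3) _ FEq(2)] inj_on_eq_iff)
next
  case (FEx v \<phi>)
  have "sat N ((\<lambda>w. h (s w))(v := h x)) \<phi> \<longleftrightarrow> sat M (s(v := x)) \<phi>" if "x \<in> carrier M" for x
  proof -
    have "(\<lambda>w. h (s w))(v := h x) = (\<lambda>w. h ((s(v := x)) w))" by auto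
    then show ?thesis using FEx.prems that by (simp only:, intro FEx.IH) auto
  qed
  moreover have "carrier N = h ` carrier M" using assms(4) by (simp add: bij_betw_def)
  ultimately show ?case by auto
qed auto

lemma finsum_restrict_carrier:
  assumes "left_module R M" "left_module R (M\<lparr>carrier := H\<rparr>)" "H \<subseteq> carrier M" "f \<in> A \<rightarrow> H"
  shows "finsum (M\<lparr>carrier := H\<rparr>) f A = finsum M f A"
proof -
  interpret M: left_module R M by fact
  interpret H: left_module R "M\<lparr>carrier := H\<rparr>" by fact
  show ?thesis
    using assms(4)
  proof (induction A rule: infinite_finite_induct)
    case (insert a A)
    then have "f \<in> A \<rightarrow> carrier (M\<lparr>carrier := H\<rparr>)" "f a \<in> carrier (M\<lparr>carrier := H\<rparr>)"
      "f \<in> A \<rightarrow> carrier M" "f a \<in> carrier M" using assms(3) by auto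
    then show ?case using insert by (simp add: H.M.finsum_insert M.M.finsum_insert)
  next
    case empty
    then show ?case using H.M.finsum_empty[of f] by simp
  \<comment> \<open>Infinite index sets remain: there both sums default to the common zero.\<close>
  qed (simp add: finsum_def finprod_def)
qed

section \<open>Solutions of pp systems\<close>

primrec pp_rows :: "'r pp \<Rightarrow> nat" where "pp_rows (PP n m A b) = n"
primrec pp_cols :: "'r pp \<Rightarrow> nat" where "pp_cols (PP n m A b) = m"
primrec pp_lhs :: "'r pp \<Rightarrow> nat \<Rightarrow> nat \<Rightarrow> 'r" where "pp_lhs (PP n m A b) = A"
primrec pp_rhs :: "'r pp \<Rightarrow> nat \<Rightarrow> 'r" where "pp_rhs (PP n m A b) = b"

text \<open>The witness is made explicit because the whole argument is about where its entries lie,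
  which \<open>pp_set\<close> hides.\<close>

definition pp_solution :: "'r pp \<Rightarrow> ('r, 'm) module \<Rightarrow> 'm \<Rightarrow> (nat \<Rightarrow> 'm) \<Rightarrow> bool" where
  "pp_solution \<phi> M x y \<longleftrightarrow> (\<forall>j<pp_cols \<phi>. y j \<in> carrier M) \<and>
    (\<forall>i<pp_rows \<phi>. (\<Oplus>\<^bsub>M\<^esub>j\<in>{..<pp_cols \<phi>}. pp_lhs \<phi> i j \<odot>\<^bsub>M\<^esub> y j) = pp_rhs \<phi> i \<odot>\<^bsub>M\<^esub> x)"

lemma pp_set_iff: "x \<in> pp_set \<phi> M \<longleftrightarrow> x \<in> carrier M \<and> (\<exists>y. pp_solution \<phi> M x y)"
  by (cases \<phi>) (simp add: pp_solution_def)

lemma pp_over_iff: "pp_over R \<phi> \<longleftrightarrow> (\<forall>i<pp_rows \<phi>. pp_rhs \<phi> i \<in> carrier R) \<and>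
    (\<forall>i<pp_rows \<phi>. \<forall>j<pp_cols \<phi>. pp_lhs \<phi> i j \<in> carrier R)"
  by (cases \<phi>) simp

lemma pp_solution_cong:
  assumes "left_module R M" "pp_over R \<phi>" "\<And>j. j < pp_cols \<phi> \<Longrightarrow> y j = z j"
    and "pp_solution \<phi> M x y"
  shows "pp_solution \<phi> M x z"
proof -
  interpret left_module R M by fact
  have y: "y j \<in> carrier M" if "j < pp_cols \<phi>" for j using assms(4) that by (simp add: pp_solution_def)
  have "(\<Oplus>\<^bsub>M\<^esub>j\<in>{..<pp_cols \<phi>}. pp_lhs \<phi> i j \<odot>\<^bsub>M\<^esub> z j) = (\<Oplus>\<^bsub>M\<^esub>j\<in>{..<pp_cols \<phi>}. pp_lhs \<phi> i j \<odot>\<^bsub>M\<^esub> y j)"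
    if "i < pp_rows \<phi>" for i
    using assms(2) that y by (intro M.finsum_cong') (auto simp: assms(3)[symmetric] pp_over_iff)
  then show ?thesis using assms(3,4) by (simp add: pp_solution_def)
qed

text \<open>\<open>S\<close> is a set of sequences closed under everything definable from finitely many of its
  members; its classes modulo \<open>V\<close> form an elementary extension of \<open>M\<close>.\<close>

locale definable_ultrapower = left_module R M
  for R :: "('r, 'x) ring_scheme" and M :: "('r, 'm) module" +
  fixes V :: "'j filter" and S :: "('j \<Rightarrow> 'm) set"
  assumes ultra: "ultra V"
    and S_carrier: "f \<in> S \<Longrightarrow> f i \<in> carrier M"
    and S_definable: "finite X \<Longrightarrow> X \<subseteq> S \<Longrightarrow> (\<And>i. g i \<in> carrier M) \<Longrightarrow>
      (\<And>i j. (\<And>f. f \<in> X \<Longrightarrow> f i = f j) \<Longrightarrow> g i = g j) \<Longrightarrow> g \<in> S"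
begin

definition cls :: "('j \<Rightarrow> 'm) \<Rightarrow> ('j \<Rightarrow> 'm) set" where
  "cls f = {g \<in> S. eventually (\<lambda>i. f i = g i) V}"

text \<open>The operations of \<open>N\<close> work on chosen representatives; \<open>N_add\<close>
  and \<open>N_smult\<close> remove the dependence on the choice.\<close>

definition rep :: "('j \<Rightarrow> 'm) set \<Rightarrow> 'j \<Rightarrow> 'm" where
  "rep X = (SOME f. f \<in> S \<and> cls f = X)"

definition N :: "('r, ('j \<Rightarrow> 'm) set) module" where
  "N = \<lparr>carrier = cls ` S, monoid.mult = (\<lambda>X Y. X), one = cls (\<lambda>_. \<zero>\<^bsub>M\<^esub>), zero = cls (\<lambda>_. \<zero>\<^bsub>M\<^esub>),
    add = (\<lambda>X Y. cls (\<lambda>i. rep X i \<oplus>\<^bsub>M\<^esub> rep Y i)), smult = (\<lambda>r X. cls (\<lambda>i. r \<odot>\<^bsub>M\<^esub> rep X i))\<rparr>"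

section \<open>The module of classes\<close>

lemma S_map: "f \<in> S \<Longrightarrow> (\<And>x. x \<in> carrier M \<Longrightarrow> F x \<in> carrier M) \<Longrightarrow> (\<lambda>i. F (f i)) \<in> S"
  by (rule S_definable[of "{f}"]) (auto simp: S_carrier)

lemma S_const: "c \<in> carrier M \<Longrightarrow> (\<lambda>_. c) \<in> S"
  by (rule S_definable[of "{}"]) auto

lemma S_add:
  assumes "f \<in> S" "g \<in> S"
  shows "(\<lambda>i. f i \<oplus>\<^bsub>M\<^esub> g i) \<in> S"
proof (rule S_definable[of "{f, g}"])
  fix i j assume eq: "\<And>h. h \<in> {f, g} \<Longrightarrow> h i = h j"
  show "f i \<oplus>\<^bsub>M\<^esub> g i = f j \<oplus>\<^bsub>M\<^esub> g j" using eq[of f] eq[of g] by simp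
qed (use assms in \<open>auto simp: S_carrier\<close>)

lemma S_neg: "f \<in> S \<Longrightarrow> (\<lambda>i. \<ominus>\<^bsub>M\<^esub> f i) \<in> S"
  by (rule S_map) auto

lemma S_smult: "r \<in> carrier R \<Longrightarrow> f \<in> S \<Longrightarrow> (\<lambda>i. r \<odot>\<^bsub>M\<^esub> f i) \<in> S"
  by (rule S_map) auto

lemmas S_intros = S_const S_add S_neg S_smult

lemma S_finsum: "finite A \<Longrightarrow> (\<And>a. a \<in> A \<Longrightarrow> y a \<in> S) \<Longrightarrow> (\<lambda>i. \<Oplus>\<^bsub>M\<^esub>a\<in>A. y a i) \<in> S"
  by (rule S_definable[of "y ` A"]) (auto simp: S_carrier intro!: M.finsum_closed M.finsum_cong')

lemma cls_eq:
  assumes "f \<in> S" "g \<in> S"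
  shows "cls f = cls g \<longleftrightarrow> eventually (\<lambda>i. f i = g i) V"
proof
  have "g \<in> cls g" using assms by (simp add: cls_def)
  moreover assume "cls f = cls g"
  ultimately have "g \<in> cls f" by (rule back_subst[of "\<lambda>X. g \<in> X", OF _ sym])
  then show "eventually (\<lambda>i. f i = g i) V" by (simp add: cls_def)
next
  assume ev: "eventually (\<lambda>i. f i = g i) V"
  have "eventually (\<lambda>i. f i = h i) V \<longleftrightarrow> eventually (\<lambda>i. g i = h i) V" for h
    by (rule eventually_subst, rule eventually_mono[OF ev]) simp
  then show "cls f = cls g" unfolding cls_def by (intro Collect_cong conj_cong refl)
qed

lemma rep:
  assumes "f \<in> S"
  shows "rep (cls f) \<in> S" "eventually (\<lambda>i. rep (cls f) i = f i) V"
proof -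
  have "rep (cls f) \<in> S \<and> cls (rep (cls f)) = cls f"
    unfolding rep_def by (rule someI[of "\<lambda>h. h \<in> S \<and> cls h = cls f" f]) (use assms in simp)
  then show "rep (cls f) \<in> S" "eventually (\<lambda>i. rep (cls f) i = f i) V"
    using assms cls_eq by blast+
qed

lemma N_carrier: "X \<in> carrier N \<longleftrightarrow> (\<exists>f\<in>S. X = cls f)"
  by (auto simp: N_def)

lemma cls_in_N: "f \<in> S \<Longrightarrow> cls f \<in> carrier N"
  by (auto simp: N_def)

lemma N_zero: "\<zero>\<^bsub>N\<^esub> = cls (\<lambda>_. \<zero>\<^bsub>M\<^esub>)"
  by (simp add: N_def)

lemma N_add: "f \<in> S \<Longrightarrow> g \<in> S \<Longrightarrow> cls f \<oplus>\<^bsub>N\<^esub> cls g = cls (\<lambda>i. f i \<oplus>\<^bsub>M\<^esub> g i)"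
  using rep[of f] rep[of g]
  by (auto simp: N_def cls_eq S_add elim: eventually_elim2)

lemma N_smult: "r \<in> carrier R \<Longrightarrow> f \<in> S \<Longrightarrow> r \<odot>\<^bsub>N\<^esub> cls f = cls (\<lambda>i. r \<odot>\<^bsub>M\<^esub> f i)"
  using rep[of f] by (auto simp: N_def cls_eq S_smult elim: eventually_mono)

lemma N_module: "left_module R N"
proof -
  have "abelian_group N"
  proof (rule abelian_groupI)
    fix X assume "X \<in> carrier N"
    then obtain f where f: "f \<in> S" "X = cls f" by (auto simp: N_carrier)
    show "\<exists>Y\<in>carrier N. Y \<oplus>\<^bsub>N\<^esub> X = \<zero>\<^bsub>N\<^esub>"
      using f by (intro bexI[of _ "cls (\<lambda>i. \<ominus>\<^bsub>M\<^esub> f i)"])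
        (auto simp: N_add N_zero S_intros cls_in_N S_carrier M.l_neg)
  qed (auto simp: N_carrier N_add N_zero S_intros S_carrier M.a_ac intro!: bexI)
  then show ?thesis
    unfolding left_module_def left_module_axioms_def
    by (auto simp: R.ring_axioms N_carrier N_add N_smult S_intros S_carrier smult_l_distr smult_r_distr
        smult_assoc1 intro!: bexI)
qed

sublocale N: left_module R N
  by (rule N_module)

lemma N_neg: "f \<in> S \<Longrightarrow> \<ominus>\<^bsub>N\<^esub> cls f = cls (\<lambda>i. \<ominus>\<^bsub>M\<^esub> f i)"
  by (rule N.M.minus_equality) (auto simp: N_add N_zero S_intros cls_in_N S_carrier M.l_neg)

lemma N_finsum:
  assumes "finite A" "\<And>a. a \<in> A \<Longrightarrow> y a \<in> S"
  shows "(\<Oplus>\<^bsub>N\<^esub>a\<in>A. cls (y a)) = cls (\<lambda>i. \<Oplus>\<^bsub>M\<^esub>a\<in>A. y a i)"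
  using assms
proof (induction A rule: finite_induct)
  case empty
  then show ?case by (simp add: N_zero)
next
  case (insert a A)
  have "(\<Oplus>\<^bsub>N\<^esub>a\<in>insert a A. cls (y a)) = cls (y a) \<oplus>\<^bsub>N\<^esub> cls (\<lambda>i. \<Oplus>\<^bsub>M\<^esub>a\<in>A. y a i)"
    using insert by (subst N.M.finsum_insert) (auto simp: cls_in_N)
  moreover have "(\<Oplus>\<^bsub>M\<^esub>a\<in>insert a A. y a i) = y a i \<oplus>\<^bsub>M\<^esub> (\<Oplus>\<^bsub>M\<^esub>a\<in>A. y a i)" for i
    using insert by (subst M.finsum_insert) (auto simp: S_carrier)
  ultimately show ?case using insert by (simp add: N_add S_finsum)
qed

section \<open>Los's theorem for formulas and for pp systems\<close>

lemma tval_N: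
  assumes "set_mterm t \<subseteq> carrier R" "range s \<subseteq> S"
  shows "(\<lambda>i. tval M (\<lambda>v. s v i) t) \<in> S \<and> tval N (\<lambda>v. cls (s v)) t = cls (\<lambda>i. tval M (\<lambda>v. s v i) t)"
  using assms by (induction t) (auto simp: S_intros N_zero N_add N_neg N_smult)

theorem sat_N:
  assumes "set_mform \<phi> \<subseteq> carrier R" "range s \<subseteq> S"
  shows "sat N (\<lambda>v. cls (s v)) \<phi> \<longleftrightarrow> eventually (\<lambda>i. sat M (\<lambda>v. s v i) \<phi>) V"
  using assms
proof (induction \<phi> arbitrary: s)
  case (FEq t u)
  then show ?case using tval_N[of t s] tval_N[of u s] by (simp add: cls_eq)
next
  case (FNot \<phi>)
  then show ?case by (simp add: ultra_not[OF ultra])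
next
  case (FAnd \<phi> \<psi>)
  then show ?case by (simp add: eventually_conj_iff)
next
  case (FEx v \<phi>)
  define P where "P i x \<longleftrightarrow> x \<in> carrier M \<and> sat M ((\<lambda>w. s w i)(v := x)) \<phi>" for i x
  have IH: "sat N ((\<lambda>w. cls (s w))(v := cls g)) \<phi> \<longleftrightarrow> eventually (\<lambda>i. P i (g i)) V" if "g \<in> S" for g
  proof -
    have 1: "(\<lambda>w. cls (s w))(v := cls g) = (\<lambda>w. cls ((s(v := g)) w))" by (rule ext) simp
    have 2: "(\<lambda>w. (s(v := g)) w i) = (\<lambda>w. s w i)(v := g i)" for i by (rule ext) simp
    have "range (s(v := g)) \<subseteq> S" using FEx.prems(2) that by auto
    then have "sat N (\<lambda>w. cls ((s(v := g)) w)) \<phi> \<longleftrightarrow> eventually (\<lambda>i. sat M (\<lambda>w. (s(v := g)) w i) \<phi>) V"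
      using FEx.prems(1) by (intro FEx.IH) auto
    then show ?thesis unfolding 1 2 by (simp add: P_def S_carrier that)
  qed
  have "(\<exists>X\<in>carrier N. sat N ((\<lambda>w. cls (s w))(v := X)) \<phi>) \<longleftrightarrow> (\<exists>g\<in>S. eventually (\<lambda>i. P i (g i)) V)"
    using IH unfolding N_carrier Bex_def by blast
  also have "\<dots> \<longleftrightarrow> eventually (\<lambda>i. \<exists>x. P i x) V"
  proof
    assume "\<exists>g\<in>S. eventually (\<lambda>i. P i (g i)) V"
    then show "eventually (\<lambda>i. \<exists>x. P i x) V" by (auto elim: eventually_mono)
  next
    assume ev: "eventually (\<lambda>i. \<exists>x. P i x) V"
    define g where "g i = (if \<exists>x. P i x then SOME x. P i x else \<zero>\<^bsub>M\<^esub>)" for i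
    have P: "P i (g i)" if "\<exists>x. P i x" for i
      using that unfolding g_def by (simp add: someI_ex)
    have "g \<in> S"
    proof (rule S_definable[of "s ` fvars \<phi>"])
      show "g i \<in> carrier M" for i
      proof (cases "\<exists>x. P i x")
        case True
        then show ?thesis using P[OF True] by (simp add: P_def)
      qed (simp add: g_def)
      fix i j assume "\<And>f. f \<in> s ` fvars \<phi> \<Longrightarrow> f i = f j"
      then have "P i = P j"
        unfolding P_def by (intro ext conj_cong refl sat_cong) auto
      then show "g i = g j" by (simp add: g_def)
    qed (use FEx.prems in auto)
    moreover have "eventually (\<lambda>i. P i (g i)) V" by (rule eventually_mono[OF ev P])
    ultimately show "\<exists>g\<in>S. eventually (\<lambda>i. P i (g i)) V" by blast
  qed
  finally show ?case by (simp add: P_def Bex_def)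
qed

lemma linear_eq_N:
  fixes m :: nat
  assumes "\<And>j. j < m \<Longrightarrow> a j \<in> carrier R" "b \<in> carrier R" "\<And>j. j < m \<Longrightarrow> y j \<in> S" "f \<in> S"
  shows "(\<Oplus>\<^bsub>N\<^esub>j\<in>{..<m}. a j \<odot>\<^bsub>N\<^esub> cls (y j)) = b \<odot>\<^bsub>N\<^esub> cls f \<longleftrightarrow>
    eventually (\<lambda>i. (\<Oplus>\<^bsub>M\<^esub>j\<in>{..<m}. a j \<odot>\<^bsub>M\<^esub> y j i) = b \<odot>\<^bsub>M\<^esub> f i) V"
proof -
  have "(\<Oplus>\<^bsub>N\<^esub>j\<in>{..<m}. a j \<odot>\<^bsub>N\<^esub> cls (y j)) = (\<Oplus>\<^bsub>N\<^esub>j\<in>{..<m}. cls (\<lambda>i. a j \<odot>\<^bsub>M\<^esub> y j i))"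
    using assms by (intro N.M.finsum_cong') (auto simp: N_smult S_smult cls_in_N)
  also have "\<dots> = cls (\<lambda>i. \<Oplus>\<^bsub>M\<^esub>j\<in>{..<m}. a j \<odot>\<^bsub>M\<^esub> y j i)"
    using assms by (intro N_finsum) (auto simp: S_smult)
  finally have sum: "(\<Oplus>\<^bsub>N\<^esub>j\<in>{..<m}. a j \<odot>\<^bsub>N\<^esub> cls (y j)) = cls (\<lambda>i. \<Oplus>\<^bsub>M\<^esub>j\<in>{..<m}. a j \<odot>\<^bsub>M\<^esub> y j i)" .
  have "(\<lambda>i. \<Oplus>\<^bsub>M\<^esub>j\<in>{..<m}. a j \<odot>\<^bsub>M\<^esub> y j i) \<in> S"
    using assms by (intro S_finsum S_smult) auto
  then show ?thesis unfolding sum using assms by (simp add: N_smult cls_eq S_smult)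
qed

lemma pp_solution_N:
  assumes "pp_over R \<phi>" "f \<in> S" "\<And>j. j < pp_cols \<phi> \<Longrightarrow> y j \<in> S"
  shows "pp_solution \<phi> N (cls f) (\<lambda>j. cls (y j)) \<longleftrightarrow>
    eventually (\<lambda>i. pp_solution \<phi> M (f i) (\<lambda>j. y j i)) V"
proof -
  let ?eq = "\<lambda>k i. (\<Oplus>\<^bsub>M\<^esub>j\<in>{..<pp_cols \<phi>}. pp_lhs \<phi> k j \<odot>\<^bsub>M\<^esub> y j i) = pp_rhs \<phi> k \<odot>\<^bsub>M\<^esub> f i"
  have "pp_solution \<phi> N (cls f) (\<lambda>j. cls (y j)) \<longleftrightarrow> (\<forall>k\<in>{..<pp_rows \<phi>}. eventually (?eq k) V)"
    using assms linear_eq_N[of "pp_cols \<phi>" "pp_lhs \<phi> _" "pp_rhs \<phi> _" y f]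
    by (auto simp: pp_solution_def pp_over_iff cls_in_N)
  also have "\<dots> \<longleftrightarrow> eventually (\<lambda>i. \<forall>k\<in>{..<pp_rows \<phi>}. ?eq k i) V"
    by (rule eventually_ball_finite_distrib[symmetric]) simp
  also have "\<dots> \<longleftrightarrow> eventually (\<lambda>i. pp_solution \<phi> M (f i) (\<lambda>j. y j i)) V"
    using assms(3) by (simp add: pp_solution_def S_carrier Ball_def)
  finally show ?thesis .
qed

text \<open>pp formulas are given by matrices and not as members of \<open>mform\<close>, so they
  get their own transfer. The complete solution is chosen from the value \<open>f i\<close> alone,
  which puts each of its entries into \<open>S\<close>.\<close>

theorem pp_set_N:
  assumes "pp_over R \<phi>" "f \<in> S"
  shows "cls f \<in> pp_set \<phi> N \<longleftrightarrow> eventually (\<lambda>i. f i \<in> pp_set \<phi> M) V"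
proof
  assume "cls f \<in> pp_set \<phi> N"
  then obtain Y where Y: "pp_solution \<phi> N (cls f) Y" by (auto simp: pp_set_iff)
  then have "\<forall>j<pp_cols \<phi>. \<exists>g\<in>S. Y j = cls g" by (simp add: pp_solution_def N_carrier)
  then obtain y where y: "\<And>j. j < pp_cols \<phi> \<Longrightarrow> y j \<in> S \<and> Y j = cls (y j)" by metis
  have "pp_solution \<phi> N (cls f) (\<lambda>j. cls (y j))"
    using y by (intro pp_solution_cong[OF N_module assms(1) _ Y]) simp
  then have "eventually (\<lambda>i. pp_solution \<phi> M (f i) (\<lambda>j. y j i)) V"
    using y assms by (simp add: pp_solution_N)
  then show "eventually (\<lambda>i. f i \<in> pp_set \<phi> M) V"
    using assms(2) by (auto simp: pp_set_iff S_carrier elim!: eventually_mono)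
next
  assume ev: "eventually (\<lambda>i. f i \<in> pp_set \<phi> M) V"
  define y where "y i = (if \<exists>y. pp_solution \<phi> M (f i) y then SOME y. pp_solution \<phi> M (f i) y
    else (\<lambda>_. \<zero>\<^bsub>M\<^esub>))" for i
  have sol: "pp_solution \<phi> M (f i) (y i)" if "\<exists>y. pp_solution \<phi> M (f i) y" for i
    using that unfolding y_def by (simp add: someI_ex)
  have yS: "(\<lambda>i. y i j) \<in> S" if "j < pp_cols \<phi>" for j
  proof (rule S_definable[of "{f}"])
    show "y i j \<in> carrier M" for i
    proof (cases "\<exists>y. pp_solution \<phi> M (f i) y")
      case True
      then show ?thesis using sol[OF True] that by (simp add: pp_solution_def)
    qed (simp add: y_def)
    fix i k assume "\<And>g. g \<in> {f} \<Longrightarrow> g i = g k"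
    then have "f i = f k" by simp
    then show "y i j = y k j" by (simp add: y_def)
  qed (use assms in auto)
  have "eventually (\<lambda>i. pp_solution \<phi> M (f i) (y i)) V"
    using ev by (rule eventually_mono) (simp add: pp_set_iff sol)
  then have "pp_solution \<phi> N (cls f) (\<lambda>j. cls (\<lambda>i. y i j))"
    using yS assms by (simp add: pp_solution_N)
  then show "cls f \<in> pp_set \<phi> N"
    using assms(2) by (auto simp: pp_set_iff cls_in_N)
qed

end

section \<open>Solutions satisfying finitely many high formulas\<close>

context left_module
begin

lemma smult_r_null: "r \<in> carrier R \<Longrightarrow> r \<odot>\<^bsub>M\<^esub> \<zero>\<^bsub>M\<^esub> = \<zero>\<^bsub>M\<^esub>"
  using smult_assoc1[of r \<zero> "\<zero>\<^bsub>M\<^esub>"] by (simp add: smult_l_null)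

lemma smult_l_minus:
  assumes "r \<in> carrier R" "x \<in> carrier M"
  shows "(\<ominus> r) \<odot>\<^bsub>M\<^esub> x = \<ominus>\<^bsub>M\<^esub> (r \<odot>\<^bsub>M\<^esub> x)"
proof -
  have "(\<ominus> r) \<odot>\<^bsub>M\<^esub> x \<oplus>\<^bsub>M\<^esub> r \<odot>\<^bsub>M\<^esub> x = \<zero>\<^bsub>M\<^esub>"
    using assms smult_l_distr[of "\<ominus> r" r x] by (simp add: smult_l_null R.l_neg)
  then show ?thesis using assms by (simp add: M.minus_equality)
qed

end

text \<open>Systems are assembled from blocks below, so arbitrary finite index types are convenient;
  an enumeration turns them into the numerical format of \<open>PP\<close>.\<close>

definition pp_indexed :: "'i set \<Rightarrow> 'j set \<Rightarrow> ('i \<Rightarrow> 'j \<Rightarrow> 'r) \<Rightarrow> ('i \<Rightarrow> 'r) \<Rightarrow> 'r pp" where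
  "pp_indexed I J A b = PP (card I) (card J)
    (\<lambda>i j. A (from_nat_into I i) (from_nat_into J j)) (\<lambda>i. b (from_nat_into I i))"

lemma all_from_nat_into:
  assumes "finite I"
  shows "(\<forall>i<card I. P (from_nat_into I i)) \<longleftrightarrow> (\<forall>i\<in>I. P i)"
proof -
  have "from_nat_into I ` {..<card I} = I"
    using bij_betw_from_nat_into_finite[OF assms] by (simp add: bij_betw_def)
  then show ?thesis by (metis (no_types, lifting) imageE imageI lessThan_iff)
qed

lemma pp_over_indexed:
  assumes "finite I" "finite J"
  shows "pp_over R (pp_indexed I J A b) \<longleftrightarrow> (\<forall>i\<in>I. b i \<in> carrier R) \<and> (\<forall>i\<in>I. \<forall>j\<in>J. A i j \<in> carrier R)"
  by (simp add: pp_indexed_def all_from_nat_into[OF assms(1), of "\<lambda>i. b i \<in> carrier R"]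
      all_from_nat_into[OF assms(2), of "\<lambda>j. A _ j \<in> carrier R"]
      all_from_nat_into[OF assms(1), of "\<lambda>i. \<forall>j\<in>J. A i j \<in> carrier R"])

lemma pp_set_indexed:
  assumes M: "left_module R M" and fin: "finite I" "finite J"
    and A: "\<And>i j. i \<in> I \<Longrightarrow> j \<in> J \<Longrightarrow> A i j \<in> carrier R"
  shows "x \<in> pp_set (pp_indexed I J A b) M \<longleftrightarrow> x \<in> carrier M \<and>
    (\<exists>y. y \<in> J \<rightarrow> carrier M \<and> (\<forall>i\<in>I. (\<Oplus>\<^bsub>M\<^esub>j\<in>J. A i j \<odot>\<^bsub>M\<^esub> y j) = b i \<odot>\<^bsub>M\<^esub> x))"
proof -
  interpret left_module R M by fact
  let ?d = "from_nat_into J"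
  have bij: "bij_betw ?d {..<card J} J" by (rule bij_betw_from_nat_into_finite[OF fin(2)])
  have img: "?d ` {..<card J} = J" and inj: "inj_on ?d {..<card J}"
    using bij by (auto simp: bij_betw_def)
  have dJ: "?d k \<in> J" if "k < card J" for k using img that by auto
  have sum: "(\<Oplus>\<^bsub>M\<^esub>k\<in>{..<card J}. A i (?d k) \<odot>\<^bsub>M\<^esub> z k) = (\<Oplus>\<^bsub>M\<^esub>j\<in>J. A i j \<odot>\<^bsub>M\<^esub> y j)"
    if "i \<in> I" "y \<in> J \<rightarrow> carrier M" "\<And>k. k < card J \<Longrightarrow> z k = y (?d k)" for i y z
  proof -
    have "(\<Oplus>\<^bsub>M\<^esub>j\<in>J. A i j \<odot>\<^bsub>M\<^esub> y j) = (\<Oplus>\<^bsub>M\<^esub>j\<in>?d ` {..<card J}. A i j \<odot>\<^bsub>M\<^esub> y j)" by (simp only: img)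
    also have "\<dots> = (\<Oplus>\<^bsub>M\<^esub>k\<in>{..<card J}. A i (?d k) \<odot>\<^bsub>M\<^esub> y (?d k))"
    proof (rule M.add.finprod_reindex[OF _ inj])
      show "(\<lambda>j. A i j \<odot>\<^bsub>M\<^esub> y j) \<in> ?d ` {..<card J} \<rightarrow> carrier M"
        unfolding img using that(1,2) A by auto
    qed
    also have "\<dots> = (\<Oplus>\<^bsub>M\<^esub>k\<in>{..<card J}. A i (?d k) \<odot>\<^bsub>M\<^esub> z k)"
      using that A dJ by (intro M.finsum_cong') (auto simp: Pi_def)
    finally show ?thesis ..
  qed
  have "(\<exists>z. (\<forall>k<card J. z k \<in> carrier M) \<and>
      (\<forall>i\<in>I. (\<Oplus>\<^bsub>M\<^esub>k\<in>{..<card J}. A i (?d k) \<odot>\<^bsub>M\<^esub> z k) = b i \<odot>\<^bsub>M\<^esub> x)) \<longleftrightarrow>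
    (\<exists>y. y \<in> J \<rightarrow> carrier M \<and> (\<forall>i\<in>I. (\<Oplus>\<^bsub>M\<^esub>j\<in>J. A i j \<odot>\<^bsub>M\<^esub> y j) = b i \<odot>\<^bsub>M\<^esub> x))" (is "?L \<longleftrightarrow> ?R")
  proof
    assume ?L
    then obtain z where z: "\<forall>k<card J. z k \<in> carrier M"
      "\<forall>i\<in>I. (\<Oplus>\<^bsub>M\<^esub>k\<in>{..<card J}. A i (?d k) \<odot>\<^bsub>M\<^esub> z k) = b i \<odot>\<^bsub>M\<^esub> x" by blast
    \<comment> \<open>The solution is carried from positions to indices by inverting the enumeration
      of \<open>J\<close>.\<close>
    define y where "y j = z (the_inv_into {..<card J} ?d j)" for j
    have zy: "z k = y (?d k)" if "k < card J" for k
      using that by (simp add: y_def the_inv_into_f_f[OF inj])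
    have y: "y \<in> J \<rightarrow> carrier M"
    proof
      fix j assume "j \<in> J"
      then obtain k where "k < card J" "j = ?d k" using img by blast
      then show "y j \<in> carrier M" using zy z(1) by auto
    qed
    show ?R using z(2) sum[OF _ y zy] y by auto
  next
    assume ?R
    then obtain y where y: "y \<in> J \<rightarrow> carrier M"
      "\<forall>i\<in>I. (\<Oplus>\<^bsub>M\<^esub>j\<in>J. A i j \<odot>\<^bsub>M\<^esub> y j) = b i \<odot>\<^bsub>M\<^esub> x" by blast
    then show ?L using sum[OF _ y(1) refl] dJ by (intro exI[of _ "\<lambda>k. y (?d k)"]) auto
  qed
  then show ?thesis
    by (simp add: pp_indexed_def all_from_nat_into[OF fin(1), of "\<lambda>i. (\<Oplus>\<^bsub>M\<^esub>k\<in>{..<card J}. A i (?d k) \<odot>\<^bsub>M\<^esub> _ k) = b i \<odot>\<^bsub>M\<^esub> x"])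
qed

text \<open>\<open>pp_bound R \<phi> F\<close> is \<open>\<exists>y. Ay = bx \<and> (\<And>j. \<And>\<psi>\<in>F. \<psi>(y\<^sub>j))\<close>, where \<open>\<phi>\<close> is \<open>\<exists>y. Ay = bx\<close>. The unknown
  \<open>Inl j\<close> is \<open>y\<^sub>j\<close>, and \<open>Inr ((j, \<psi>), k)\<close> is the \<open>k\<close>-th unknown of the copy of \<open>\<psi>\<close> for \<open>y\<^sub>j\<close>; the
  equations are indexed in the same way.\<close>

fun bound_lhs :: "('r, 'x) ring_scheme \<Rightarrow> 'r pp \<Rightarrow> nat + (nat \<times> 'r pp) \<times> nat \<Rightarrow>
    nat + (nat \<times> 'r pp) \<times> nat \<Rightarrow> 'r" where
  "bound_lhs R \<phi> (Inl i) (Inl j) = pp_lhs \<phi> i j"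
| "bound_lhs R \<phi> (Inl i) (Inr q) = \<zero>\<^bsub>R\<^esub>"
| "bound_lhs R \<phi> (Inr (p, i)) (Inl j) = (if j = fst p then \<ominus>\<^bsub>R\<^esub> pp_rhs (snd p) i else \<zero>\<^bsub>R\<^esub>)"
| "bound_lhs R \<phi> (Inr (p, i)) (Inr (q, k)) = (if q = p then pp_lhs (snd p) i k else \<zero>\<^bsub>R\<^esub>)"

fun bound_rhs :: "('r, 'x) ring_scheme \<Rightarrow> 'r pp \<Rightarrow> nat + (nat \<times> 'r pp) \<times> nat \<Rightarrow> 'r" where
  "bound_rhs R \<phi> (Inl i) = pp_rhs \<phi> i"
| "bound_rhs R \<phi> (Inr q) = \<zero>\<^bsub>R\<^esub>"

definition pp_bound :: "('r, 'x) ring_scheme \<Rightarrow> 'r pp \<Rightarrow> 'r pp set \<Rightarrow> 'r pp" where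
  "pp_bound R \<phi> F = pp_indexed
    (Inl ` {..<pp_rows \<phi>} \<union> Inr ` (SIGMA p:{..<pp_cols \<phi>} \<times> F. {..<pp_rows (snd p)}))
    (Inl ` {..<pp_cols \<phi>} \<union> Inr ` (SIGMA p:{..<pp_cols \<phi>} \<times> F. {..<pp_cols (snd p)}))
    (bound_lhs R \<phi>) (bound_rhs R \<phi>)"

section \<open>Evaluating the combined system\<close>

lemma bound_lhs_closed:
  assumes "ring R" "pp_over R \<phi>" "\<forall>\<psi>\<in>F. pp_over R \<psi>"
    and "i \<in> Inl ` {..<pp_rows \<phi>} \<union> Inr ` (SIGMA p:{..<pp_cols \<phi>} \<times> F. {..<pp_rows (snd p)})"
    and "j \<in> Inl ` {..<pp_cols \<phi>} \<union> Inr ` (SIGMA p:{..<pp_cols \<phi>} \<times> F. {..<pp_cols (snd p)})"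
  shows "bound_lhs R \<phi> i j \<in> carrier R"
proof -
  interpret ring R by fact
  show ?thesis using assms(2-) by (auto simp: pp_over_iff)
qed

lemma pp_over_bound:
  assumes "ring R" "finite F" "pp_over R \<phi>" "\<forall>\<psi>\<in>F. pp_over R \<psi>"
  shows "pp_over R (pp_bound R \<phi> F)"
  unfolding pp_bound_def
proof (subst pp_over_indexed; (intro conjI ballI)?)
  interpret ring R by fact
  fix i assume "i \<in> Inl ` {..<pp_rows \<phi>} \<union> Inr ` (SIGMA p:{..<pp_cols \<phi>} \<times> F. {..<pp_rows (snd p)})"
  then show "bound_rhs R \<phi> i \<in> carrier R" using assms(3) by (auto simp: pp_over_iff)
qed (use assms(2) in \<open>auto intro: bound_lhs_closed[OF assms(1,3,4)]\<close>)

lemma bound_sum_Inl: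
  assumes "left_module R M" "finite F" "pp_over R \<phi>" "\<forall>\<psi>\<in>F. pp_over R \<psi>"
    and J: "J = Inl ` {..<pp_cols \<phi>} \<union> Inr ` (SIGMA p:{..<pp_cols \<phi>} \<times> F. {..<pp_cols (snd p)})"
    and w: "w \<in> J \<rightarrow> carrier M" and i: "i < pp_rows \<phi>"
  shows "(\<Oplus>\<^bsub>M\<^esub>j\<in>J. bound_lhs R \<phi> (Inl i) j \<odot>\<^bsub>M\<^esub> w j) =
    (\<Oplus>\<^bsub>M\<^esub>j\<in>{..<pp_cols \<phi>}. pp_lhs \<phi> i j \<odot>\<^bsub>M\<^esub> w (Inl j))"
proof -
  interpret left_module R M by fact
  have fin: "finite J" using assms(2) by (simp add: J)
  have A: "bound_lhs R \<phi> (Inl i) j \<in> carrier R" if "j \<in> J" for j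
    using i that unfolding J by (intro bound_lhs_closed[OF R.ring_axioms assms(3,4)]) auto
  have wJ: "w j \<in> carrier M" if "j \<in> J" for j using w that by auto
  have "(\<Oplus>\<^bsub>M\<^esub>j\<in>J. bound_lhs R \<phi> (Inl i) j \<odot>\<^bsub>M\<^esub> w j) =
    (\<Oplus>\<^bsub>M\<^esub>j\<in>Inl ` {..<pp_cols \<phi>}. bound_lhs R \<phi> (Inl i) j \<odot>\<^bsub>M\<^esub> w j)"
  proof (rule M.add.finprod_mono_neutral_cong_right[OF fin])
    show "Inl ` {..<pp_cols \<phi>} \<subseteq> J" by (auto simp: J)
    fix j assume j: "j \<in> J - Inl ` {..<pp_cols \<phi>}"
    then obtain q where "j = Inr q" by (auto simp: J)
    then show "bound_lhs R \<phi> (Inl i) j \<odot>\<^bsub>M\<^esub> w j = \<zero>\<^bsub>M\<^esub>" using wJ[of j] j by (simp add: smult_l_null)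
  qed (use A wJ in auto)
  also have "\<dots> = (\<Oplus>\<^bsub>M\<^esub>j\<in>{..<pp_cols \<phi>}. bound_lhs R \<phi> (Inl i) (Inl j) \<odot>\<^bsub>M\<^esub> w (Inl j))"
  proof (rule M.add.finprod_reindex)
    show "(\<lambda>j. bound_lhs R \<phi> (Inl i) j \<odot>\<^bsub>M\<^esub> w j) \<in> Inl ` {..<pp_cols \<phi>} \<rightarrow> carrier M"
      using A wJ by (intro Pi_I smult_closed) (auto simp: J)
  qed auto
  finally show ?thesis by simp
qed

text \<open>In a copy of \<open>\<psi>\<close> the free variable has become the unknown
  \<open>Inl l\<close>. Its term therefore stands on the left with a minus sign, and
  \<open>bound_rhs\<close> is zero there. All columns other than this one and those of the same copy
  have coefficient zero.\<close>

lemma bound_sum_Inr: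
  assumes "left_module R M" "finite F" "pp_over R \<phi>" "\<forall>\<psi>\<in>F. pp_over R \<psi>"
    and J: "J = Inl ` {..<pp_cols \<phi>} \<union> Inr ` (SIGMA p:{..<pp_cols \<phi>} \<times> F. {..<pp_cols (snd p)})"
    and w: "w \<in> J \<rightarrow> carrier M" and l: "l < pp_cols \<phi>" "\<psi> \<in> F" and i: "i < pp_rows \<psi>"
  shows "(\<Oplus>\<^bsub>M\<^esub>j\<in>J. bound_lhs R \<phi> (Inr ((l, \<psi>), i)) j \<odot>\<^bsub>M\<^esub> w j) =
    \<ominus>\<^bsub>M\<^esub> (pp_rhs \<psi> i \<odot>\<^bsub>M\<^esub> w (Inl l)) \<oplus>\<^bsub>M\<^esub>
    (\<Oplus>\<^bsub>M\<^esub>k\<in>{..<pp_cols \<psi>}. pp_lhs \<psi> i k \<odot>\<^bsub>M\<^esub> w (Inr ((l, \<psi>), k)))"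
proof -
  interpret left_module R M by fact
  let ?r = "Inr ((l, \<psi>), i)" and ?K = "(\<lambda>k. Inr ((l, \<psi>), k)) ` {..<pp_cols \<psi>}"
  have fin: "finite J" using assms(2) by (simp add: J)
  have A: "bound_lhs R \<phi> ?r j \<in> carrier R" if "j \<in> J" for j
    using l i that unfolding J by (intro bound_lhs_closed[OF R.ring_axioms assms(3,4)]) auto
  have wJ: "w j \<in> carrier M" if "j \<in> J" for j using w that by auto
  have KJ: "insert (Inl l) ?K \<subseteq> J" using l by (auto simp: J)
  have tm: "bound_lhs R \<phi> ?r j \<odot>\<^bsub>M\<^esub> w j \<in> carrier M" if "j \<in> J" for j
    using A wJ that by (intro smult_closed) auto
  have "(\<Oplus>\<^bsub>M\<^esub>j\<in>J. bound_lhs R \<phi> ?r j \<odot>\<^bsub>M\<^esub> w j) =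
    (\<Oplus>\<^bsub>M\<^esub>j\<in>insert (Inl l) ?K. bound_lhs R \<phi> ?r j \<odot>\<^bsub>M\<^esub> w j)"
  proof (rule M.add.finprod_mono_neutral_cong_right[OF fin KJ])
    fix j assume j: "j \<in> J - insert (Inl l) ?K"
    then have "bound_lhs R \<phi> ?r j = \<zero>\<^bsub>R\<^esub>" by (auto simp: J)
    then show "bound_lhs R \<phi> ?r j \<odot>\<^bsub>M\<^esub> w j = \<zero>\<^bsub>M\<^esub>" using wJ[of j] j by (simp add: smult_l_null)
  qed (use tm in auto)
  also have "\<dots> = bound_lhs R \<phi> ?r (Inl l) \<odot>\<^bsub>M\<^esub> w (Inl l) \<oplus>\<^bsub>M\<^esub> (\<Oplus>\<^bsub>M\<^esub>j\<in>?K. bound_lhs R \<phi> ?r j \<odot>\<^bsub>M\<^esub> w j)"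
    using KJ by (intro M.finsum_insert) (auto intro!: tm simp del: bound_lhs.simps)
  also have "(\<Oplus>\<^bsub>M\<^esub>j\<in>?K. bound_lhs R \<phi> ?r j \<odot>\<^bsub>M\<^esub> w j) =
      (\<Oplus>\<^bsub>M\<^esub>k\<in>{..<pp_cols \<psi>}. bound_lhs R \<phi> ?r (Inr ((l, \<psi>), k)) \<odot>\<^bsub>M\<^esub> w (Inr ((l, \<psi>), k)))"
    by (rule M.add.finprod_reindex) (use KJ in \<open>auto intro!: tm simp: inj_on_def simp del: bound_lhs.simps\<close>)
  also have "bound_lhs R \<phi> ?r (Inl l) \<odot>\<^bsub>M\<^esub> w (Inl l) = \<ominus>\<^bsub>M\<^esub> (pp_rhs \<psi> i \<odot>\<^bsub>M\<^esub> w (Inl l))"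
    using assms(4) l(2) i wJ KJ by (simp add: smult_l_minus pp_over_iff)
  finally show ?thesis by simp
qed

theorem pp_set_bound:
  assumes M: "left_module R M" and F: "finite F" and over: "pp_over R \<phi>" "\<forall>\<psi>\<in>F. pp_over R \<psi>"
  shows "x \<in> pp_set (pp_bound R \<phi> F) M \<longleftrightarrow> x \<in> carrier M \<and>
    (\<exists>y. pp_solution \<phi> M x y \<and> (\<forall>j<pp_cols \<phi>. \<forall>\<psi>\<in>F. y j \<in> pp_set \<psi> M))"
proof (cases "x \<in> carrier M")
  case x: True
  interpret left_module R M by fact
  define I where "I = Inl ` {..<pp_rows \<phi>} \<union> Inr ` (SIGMA p:{..<pp_cols \<phi>} \<times> F. {..<pp_rows (snd p)})"
  define J where "J = Inl ` {..<pp_cols \<phi>} \<union> Inr ` (SIGMA p:{..<pp_cols \<phi>} \<times> F. {..<pp_cols (snd p)})"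
  have fin: "finite I" "finite J" using F by (auto simp: I_def J_def)
  have 1: "x \<in> pp_set (pp_bound R \<phi> F) M \<longleftrightarrow> (\<exists>w. w \<in> J \<rightarrow> carrier M \<and>
      (\<forall>i\<in>I. (\<Oplus>\<^bsub>M\<^esub>j\<in>J. bound_lhs R \<phi> i j \<odot>\<^bsub>M\<^esub> w j) = bound_rhs R \<phi> i \<odot>\<^bsub>M\<^esub> x))"
    unfolding pp_bound_def I_def[symmetric] J_def[symmetric]
    by (subst pp_set_indexed[OF M fin])
      (use x in \<open>auto simp: I_def J_def intro: bound_lhs_closed[OF R.ring_axioms over]\<close>)
  have cancel: "\<ominus>\<^bsub>M\<^esub> u \<oplus>\<^bsub>M\<^esub> v = \<zero>\<^bsub>M\<^esub> \<longleftrightarrow> v = u" if "u \<in> carrier M" "v \<in> carrier M" for u v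
    using that by (metis M.a_inv_closed M.l_neg M.minus_equality M.minus_minus)
  have 2: "(\<forall>i\<in>I. (\<Oplus>\<^bsub>M\<^esub>j\<in>J. bound_lhs R \<phi> i j \<odot>\<^bsub>M\<^esub> w j) = bound_rhs R \<phi> i \<odot>\<^bsub>M\<^esub> x) \<longleftrightarrow>
      pp_solution \<phi> M x (\<lambda>j. w (Inl j)) \<and>
      (\<forall>j<pp_cols \<phi>. \<forall>\<psi>\<in>F. pp_solution \<psi> M (w (Inl j)) (\<lambda>k. w (Inr ((j, \<psi>), k))))"
    if w: "w \<in> J \<rightarrow> carrier M" for w
  proof -
    have wl: "w (Inl j) \<in> carrier M" if "j < pp_cols \<phi>" for j using w that by (auto simp: J_def)
    have wr: "w (Inr ((j, \<psi>), k)) \<in> carrier M" if "j < pp_cols \<phi>" "\<psi> \<in> F" "k < pp_cols \<psi>" for j \<psi> k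
      using w that by (auto simp: J_def)
    have "(\<Oplus>\<^bsub>M\<^esub>j\<in>J. bound_lhs R \<phi> (Inr ((l, \<psi>), i)) j \<odot>\<^bsub>M\<^esub> w j) = \<zero>\<^bsub>M\<^esub> \<longleftrightarrow>
      (\<Oplus>\<^bsub>M\<^esub>k\<in>{..<pp_cols \<psi>}. pp_lhs \<psi> i k \<odot>\<^bsub>M\<^esub> w (Inr ((l, \<psi>), k))) = pp_rhs \<psi> i \<odot>\<^bsub>M\<^esub> w (Inl l)"
      if "l < pp_cols \<phi>" "\<psi> \<in> F" "i < pp_rows \<psi>" for l \<psi> i
      unfolding bound_sum_Inr[OF M F over J_def w that]
      using over(2) that wl wr
      by (intro cancel M.finsum_closed Pi_I smult_closed) (auto simp: pp_over_iff)
    then show ?thesis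
      using wl wr x bound_sum_Inl[OF M F over J_def w]
      by (auto simp: I_def pp_solution_def ball_Un smult_l_null)
  qed
  have "x \<in> pp_set (pp_bound R \<phi> F) M \<longleftrightarrow> (\<exists>w. w \<in> J \<rightarrow> carrier M \<and>
      pp_solution \<phi> M x (\<lambda>j. w (Inl j)) \<and>
      (\<forall>j<pp_cols \<phi>. \<forall>\<psi>\<in>F. pp_solution \<psi> M (w (Inl j)) (\<lambda>k. w (Inr ((j, \<psi>), k)))))"
    using 1 2 by blast
  also have "\<dots> \<longleftrightarrow> (\<exists>y. pp_solution \<phi> M x y \<and> (\<forall>j<pp_cols \<phi>. \<forall>\<psi>\<in>F. y j \<in> pp_set \<psi> M))"
  proof
    assume "\<exists>w. w \<in> J \<rightarrow> carrier M \<and> pp_solution \<phi> M x (\<lambda>j. w (Inl j)) \<and>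
      (\<forall>j<pp_cols \<phi>. \<forall>\<psi>\<in>F. pp_solution \<psi> M (w (Inl j)) (\<lambda>k. w (Inr ((j, \<psi>), k))))"
    then obtain w where w: "w \<in> J \<rightarrow> carrier M" "pp_solution \<phi> M x (\<lambda>j. w (Inl j))"
      "\<forall>j<pp_cols \<phi>. \<forall>\<psi>\<in>F. pp_solution \<psi> M (w (Inl j)) (\<lambda>k. w (Inr ((j, \<psi>), k)))" by blast
    have "w (Inl j) \<in> carrier M" if "j < pp_cols \<phi>" for j using w(1) that by (auto simp: J_def)
    then show "\<exists>y. pp_solution \<phi> M x y \<and> (\<forall>j<pp_cols \<phi>. \<forall>\<psi>\<in>F. y j \<in> pp_set \<psi> M)"
      using w(2,3) unfolding pp_set_iff by blast
  next
    assume "\<exists>y. pp_solution \<phi> M x y \<and> (\<forall>j<pp_cols \<phi>. \<forall>\<psi>\<in>F. y j \<in> pp_set \<psi> M)"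
    then obtain y where y: "pp_solution \<phi> M x y"
      "\<forall>j<pp_cols \<phi>. \<forall>\<psi>\<in>F. \<exists>z. pp_solution \<psi> M (y j) z" unfolding pp_set_iff by blast
    from y(2) obtain z where z: "\<forall>j<pp_cols \<phi>. \<forall>\<psi>\<in>F. pp_solution \<psi> M (y j) (z j \<psi>)" by metis
    \<comment> \<open>The solution of \<open>\<phi>\<close> and the separately chosen solutions of
      the copies are laid side by side, one block per copy.\<close>
    have "case_sum y (\<lambda>((j, \<psi>), k). z j \<psi> k) \<in> J \<rightarrow> carrier M"
      using y(1) z by (auto simp: J_def pp_solution_def)
    then show "\<exists>w. w \<in> J \<rightarrow> carrier M \<and> pp_solution \<phi> M x (\<lambda>j. w (Inl j)) \<and>
      (\<forall>j<pp_cols \<phi>. \<forall>\<psi>\<in>F. pp_solution \<psi> M (w (Inl j)) (\<lambda>k. w (Inr ((j, \<psi>), k))))"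
      using y(1) z by (intro exI[of _ "case_sum y (\<lambda>((j, \<psi>), k). z j \<psi> k)"]) simp
  qed
  finally show ?thesis using x by simp
qed (simp add: pp_set_iff)

text \<open>In an injective module every high formula defines the whole module, so any solution of
  \<open>\<phi>\<close> satisfies the added conditions automatically.\<close>

lemma high_bound:
  assumes "ring R" "high R \<phi>" "finite F" "\<forall>\<psi>\<in>F. high R \<psi>"
  shows "high R (pp_bound R \<phi> F)"
  unfolding high_def
proof (intro conjI allI impI)
  have over: "pp_over R \<phi>" "\<forall>\<psi>\<in>F. pp_over R \<psi>" using assms by (auto simp: high_def)
  then show "pp_over R (pp_bound R \<phi> F)" using assms by (intro pp_over_bound)
  fix E :: "('a, 'a univ) module"
  assume E: "injective R E"
  then have mod: "left_module R E" by (simp add: injective_def)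
  have all: "pp_set \<phi> E = carrier E" "\<And>\<psi>. \<psi> \<in> F \<Longrightarrow> pp_set \<psi> E = carrier E"
    using assms E by (auto simp: high_def)
  show "pp_set (pp_bound R \<phi> F) E = carrier E"
  proof
    show "pp_set (pp_bound R \<phi> F) E \<subseteq> carrier E" by (auto simp: pp_set_iff)
    show "carrier E \<subseteq> pp_set (pp_bound R \<phi> F) E"
    proof
      fix x assume x: "x \<in> carrier E"
      then obtain y where "pp_solution \<phi> E x y" using all(1) pp_set_iff[of x \<phi> E] by auto
      then show "x \<in> pp_set (pp_bound R \<phi> F) E"
        using x unfolding pp_set_bound[OF mod assms(3) over] by (auto simp: all(2) pp_solution_def)
    qed
  qed
qed

section \<open>Ulm submodules\<close>

lemma pp_set_zero:
  assumes "left_module R M" "pp_over R \<phi>"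
  shows "\<zero>\<^bsub>M\<^esub> \<in> pp_set \<phi> M"
proof -
  interpret left_module R M by fact
  have "(\<Oplus>\<^bsub>M\<^esub>j\<in>{..<pp_cols \<phi>}. pp_lhs \<phi> i j \<odot>\<^bsub>M\<^esub> \<zero>\<^bsub>M\<^esub>) = \<zero>\<^bsub>M\<^esub>" if "i < pp_rows \<phi>" for i
  proof -
    have "(\<Oplus>\<^bsub>M\<^esub>j\<in>{..<pp_cols \<phi>}. pp_lhs \<phi> i j \<odot>\<^bsub>M\<^esub> \<zero>\<^bsub>M\<^esub>) = (\<Oplus>\<^bsub>M\<^esub>j\<in>{..<pp_cols \<phi>}. \<zero>\<^bsub>M\<^esub>)"
      using assms that by (intro M.finsum_cong') (auto simp: pp_over_iff smult_r_null)
    then show ?thesis by simp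
  qed
  then have "pp_solution \<phi> M \<zero>\<^bsub>M\<^esub> (\<lambda>_. \<zero>\<^bsub>M\<^esub>)"
    using assms by (simp add: pp_solution_def pp_over_iff smult_r_null)
  then show ?thesis by (auto simp: pp_set_iff)
qed

lemma pp_set_add:
  assumes "left_module R M" "pp_over R \<phi>" "x \<in> pp_set \<phi> M" "x' \<in> pp_set \<phi> M"
  shows "x \<oplus>\<^bsub>M\<^esub> x' \<in> pp_set \<phi> M"
proof -
  interpret left_module R M by fact
  obtain y y' where y: "pp_solution \<phi> M x y" "pp_solution \<phi> M x' y'" and x: "x \<in> carrier M" "x' \<in> carrier M"
    using assms(3,4) by (auto simp: pp_set_iff)
  have "(\<Oplus>\<^bsub>M\<^esub>j\<in>{..<pp_cols \<phi>}. pp_lhs \<phi> i j \<odot>\<^bsub>M\<^esub> (y j \<oplus>\<^bsub>M\<^esub> y' j)) = pp_rhs \<phi> i \<odot>\<^bsub>M\<^esub> (x \<oplus>\<^bsub>M\<^esub> x')"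
    if i: "i < pp_rows \<phi>" for i
  proof -
    have "(\<Oplus>\<^bsub>M\<^esub>j\<in>{..<pp_cols \<phi>}. pp_lhs \<phi> i j \<odot>\<^bsub>M\<^esub> (y j \<oplus>\<^bsub>M\<^esub> y' j)) =
      (\<Oplus>\<^bsub>M\<^esub>j\<in>{..<pp_cols \<phi>}. pp_lhs \<phi> i j \<odot>\<^bsub>M\<^esub> y j \<oplus>\<^bsub>M\<^esub> pp_lhs \<phi> i j \<odot>\<^bsub>M\<^esub> y' j)"
      using assms(2) i y by (intro M.finsum_cong') (auto simp: pp_over_iff pp_solution_def smult_r_distr)
    also have "\<dots> = (\<Oplus>\<^bsub>M\<^esub>j\<in>{..<pp_cols \<phi>}. pp_lhs \<phi> i j \<odot>\<^bsub>M\<^esub> y j) \<oplus>\<^bsub>M\<^esub>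
        (\<Oplus>\<^bsub>M\<^esub>j\<in>{..<pp_cols \<phi>}. pp_lhs \<phi> i j \<odot>\<^bsub>M\<^esub> y' j)"
      using assms(2) i y by (intro M.finsum_addf) (auto simp: pp_over_iff pp_solution_def)
    finally show ?thesis
      using assms(2) i x y by (simp add: pp_solution_def pp_over_iff smult_r_distr)
  qed
  then have "pp_solution \<phi> M (x \<oplus>\<^bsub>M\<^esub> x') (\<lambda>j. y j \<oplus>\<^bsub>M\<^esub> y' j)"
    using y by (simp add: pp_solution_def)
  then show ?thesis using x by (auto simp: pp_set_iff)
qed

text \<open>This is the formula \<phi>(rx). A single \<phi>(M) is in general only a subgroup; the
  Ulm submodule is closed under r because \<phi>(rx) is high along with \<phi>, as rE lies in E =
  \<phi>(E).\<close>

definition pp_scale :: "('r, 'x) ring_scheme \<Rightarrow> 'r \<Rightarrow> 'r pp \<Rightarrow> 'r pp" where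
  "pp_scale R r \<phi> = PP (pp_rows \<phi>) (pp_cols \<phi>) (pp_lhs \<phi>) (\<lambda>i. pp_rhs \<phi> i \<otimes>\<^bsub>R\<^esub> r)"

lemma pp_over_scale: "ring R \<Longrightarrow> pp_over R \<phi> \<Longrightarrow> r \<in> carrier R \<Longrightarrow> pp_over R (pp_scale R r \<phi>)"
  by (simp add: pp_scale_def pp_over_iff ring.ring_simprules)

lemma pp_set_scale:
  assumes "left_module R M" "pp_over R \<phi>" "r \<in> carrier R" "x \<in> carrier M"
  shows "x \<in> pp_set (pp_scale R r \<phi>) M \<longleftrightarrow> r \<odot>\<^bsub>M\<^esub> x \<in> pp_set \<phi> M"
proof -
  interpret left_module R M by fact
  show ?thesis
    using assms(2-) by (simp add: pp_set_iff pp_solution_def pp_scale_def pp_over_iff smult_assoc1)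
qed

lemma high_scale:
  assumes "ring R" "high R \<phi>" "r \<in> carrier R"
  shows "high R (pp_scale R r \<phi>)"
  unfolding high_def
proof (intro conjI allI impI)
  have over: "pp_over R \<phi>" using assms(2) by (simp add: high_def)
  then show "pp_over R (pp_scale R r \<phi>)" using assms by (simp add: pp_over_scale)
  fix E :: "('a, 'a univ) module"
  assume E: "injective R E"
  then interpret E: left_module R E by (simp add: injective_def)
  have "pp_set \<phi> E = carrier E" using assms(2) E by (auto simp: high_def)
  then show "pp_set (pp_scale R r \<phi>) E = carrier E"
    using pp_set_scale[OF E.left_module_axioms over assms(3)] assms(3)
    by (auto simp: pp_set_iff[of _ "pp_scale R r \<phi>"])
qed

text \<open>A system without equations shows that the family of high formulas is nonempty, so that
  the intersection in \<open>ulm\<close> stays inside the carrier.\<close>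

lemma high_trivial: "high R (PP 0 0 A b)"
  by (simp add: high_def)

lemma carrier_ulm: "x \<in> carrier (ulm R M) \<longleftrightarrow> x \<in> carrier M \<and> (\<forall>\<phi>. high R \<phi> \<longrightarrow> x \<in> pp_set \<phi> M)"
  using high_trivial[of R undefined undefined] by (fastforce simp: ulm_def pp_set_iff)

lemma ulm_module:
  assumes "left_module R M"
  shows "left_module R (ulm R M)"
proof -
  interpret left_module R M by fact
  have "left_module R (M\<lparr>carrier := carrier (ulm R M)\<rparr>)"
  proof (rule restrict_left_module)
    show "carrier (ulm R M) \<subseteq> carrier M" by (auto simp: carrier_ulm)
    have "\<zero>\<^bsub>M\<^esub> \<in> carrier (ulm R M)" by (simp add: carrier_ulm pp_set_zero[OF assms] high_def)
    then show "carrier (ulm R M) \<noteq> {}" by blast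
    show "x \<oplus>\<^bsub>M\<^esub> y \<in> carrier (ulm R M)" if "x \<in> carrier (ulm R M)" "y \<in> carrier (ulm R M)" for x y
      using that by (auto simp: carrier_ulm pp_set_add[OF assms] high_def)
    show "r \<odot>\<^bsub>M\<^esub> x \<in> carrier (ulm R M)" if r: "r \<in> carrier R" and x: "x \<in> carrier (ulm R M)" for r x
      unfolding carrier_ulm
    proof (intro conjI allI impI)
      show "r \<odot>\<^bsub>M\<^esub> x \<in> carrier M" using r x by (simp add: carrier_ulm)
      fix \<phi> assume \<phi>: "high R \<phi>"
      then have "x \<in> pp_set (pp_scale R r \<phi>) M"
        using x high_scale[OF R.ring_axioms \<phi> r] by (simp add: carrier_ulm)
      then show "r \<odot>\<^bsub>M\<^esub> x \<in> pp_set \<phi> M"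
        using \<phi> r x by (simp add: pp_set_scale[OF assms] carrier_ulm high_def)
    qed
  qed
  then show ?thesis by (simp add: ulm_def)
qed

lemma pp_solution_ulm:
  assumes "left_module R M" "pp_over R \<phi>" "pp_solution \<phi> M x y"
    and "\<And>j. j < pp_cols \<phi> \<Longrightarrow> y j \<in> carrier (ulm R M)"
  shows "pp_solution \<phi> (ulm R M) x y"
proof -
  interpret U: left_module R "ulm R M" using assms(1) by (rule ulm_module)
  define K where "K = carrier (ulm R M)"
  have U: "ulm R M = M\<lparr>carrier := K\<rparr>" by (simp add: K_def ulm_def)
  have mod: "left_module R (M\<lparr>carrier := K\<rparr>)" using U.left_module_axioms by (simp only: U)
  have sm: "r \<odot>\<^bsub>ulm R M\<^esub> z = r \<odot>\<^bsub>M\<^esub> z" for r z by (simp add: ulm_def)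
  have "(\<Oplus>\<^bsub>ulm R M\<^esub>j\<in>{..<pp_cols \<phi>}. pp_lhs \<phi> i j \<odot>\<^bsub>M\<^esub> y j) =
    (\<Oplus>\<^bsub>M\<^esub>j\<in>{..<pp_cols \<phi>}. pp_lhs \<phi> i j \<odot>\<^bsub>M\<^esub> y j)" if "i < pp_rows \<phi>" for i
    unfolding U
  proof (rule finsum_restrict_carrier[OF assms(1) mod])
    show "(\<lambda>j. pp_lhs \<phi> i j \<odot>\<^bsub>M\<^esub> y j) \<in> {..<pp_cols \<phi>} \<rightarrow> K"
      using assms(2,4) that U.smult_closed by (auto simp: pp_over_iff K_def sm)
  qed (auto simp: carrier_ulm K_def)
  then show ?thesis using assms(3,4) by (simp add: pp_solution_def sm)
qed

text \<open>Membership in the second Ulm submodule is about solutions in \<open>ulm R N\<close>. The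
  criterion moves them into \<open>N\<close>, where being a solution and lying in each high subgroup
  are separate conditions, both within reach of Los's theorem.\<close>

lemma ulm_ulm_eqI:
  assumes "left_module R N"
    and "\<And>\<phi> x. high R \<phi> \<Longrightarrow> x \<in> carrier (ulm R N) \<Longrightarrow>
      \<exists>y. pp_solution \<phi> N x y \<and> (\<forall>j<pp_cols \<phi>. y j \<in> carrier (ulm R N))"
  shows "carrier (ulm R (ulm R N)) = carrier (ulm R N)"
proof
  show "carrier (ulm R (ulm R N)) \<subseteq> carrier (ulm R N)" by (auto simp: carrier_ulm[of _ R "ulm R N"])
  show "carrier (ulm R N) \<subseteq> carrier (ulm R (ulm R N))"
  proof
    fix x assume x: "x \<in> carrier (ulm R N)"
    have "x \<in> pp_set \<phi> (ulm R N)" if \<phi>: "high R \<phi>" for \<phi>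
    proof -
      obtain y where "pp_solution \<phi> N x y" "\<And>j. j < pp_cols \<phi> \<Longrightarrow> y j \<in> carrier (ulm R N)"
        using assms(2)[OF \<phi> x] by blast
      then have "pp_solution \<phi> (ulm R N) x y"
        using \<phi> by (intro pp_solution_ulm[OF assms(1)]) (auto simp: high_def)
      then show ?thesis using x by (auto simp: pp_set_iff)
    qed
    then show "x \<in> carrier (ulm R (ulm R N))" using x by (simp add: carrier_ulm[of _ R "ulm R N"])
  qed
qed

section \<open>Ulm powers at the ordinals 0 and 1\<close>

lemma ulm_pow_empty: "ulm_pow R M {} = M"
  by (subst ulm_pow.simps) simp

lemma natLeq_on_1: "natLeq_on 1 = {(0, 0)}"
  by auto

lemma ulm_pow_one: "ulm_pow R M (natLeq_on 1) = ulm R M"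
proof -
  have great: "is_greatest {(0::nat, 0)} = (\<lambda>m. m = 0)"
    by (auto simp: is_greatest_def Field_def)
  have wo: "Well_order {(0::nat, 0)}"
    using natLeq_on_Well_order[of 1] unfolding natLeq_on_1 .
  have under: "underS {(0::nat, 0)} 0 = {}" by (auto simp: underS_def)
  \<comment> \<open>Nothing lies strictly below the greatest element 0, so the predecessor is the
    empty order.\<close>
  have "ulm_pow R M {(0::nat, 0)} = ulm R (ulm_pow R M ({} :: nat rel))"
    by (subst ulm_pow.simps) (use wo in \<open>simp add: great under Field_def\<close>)
  then show ?thesis by (simp only: natLeq_on_1 ulm_pow_empty)
qed

text \<open>A strict embedding has a proper subset of at most one point as its image, hence an empty
  one. This settles the minimality clause of the Ulm length: below 1 there is only 0, and below 0
  nothing.\<close>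

lemma ordLess_Field_singleton:
  assumes "\<sigma> <o \<tau>" "Field \<tau> \<subseteq> {x}"
  shows "\<sigma> = {}" "\<tau> \<noteq> {}"
proof -
  have wo: "Well_order \<sigma>" using assms(1) by (auto simp: ordLess_def)
  obtain f where f: "embed \<sigma> \<tau> f" "\<not> bij_betw f (Field \<sigma>) (Field \<tau>)"
    using assms by (auto simp: ordLess_def embedS_def)
  have "inj_on f (Field \<sigma>)" using embed_inj_on[OF wo f(1)] .
  then have ne: "f ` Field \<sigma> \<noteq> Field \<tau>" using f(2) by (simp add: bij_betw_def)
  have sub: "f ` Field \<sigma> \<subseteq> Field \<tau>" using embed_Field[OF f(1)] .
  then have "f ` Field \<sigma> = {}" "Field \<tau> \<noteq> {}"
    using ne assms(2) subset_singletonD[of "f ` Field \<sigma>" x] subset_singletonD[of "Field \<tau>" x] by auto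
  then show "\<sigma> = {}" "\<tau> \<noteq> {}" by (auto simp: Field_def)
qed

lemma ulm_length_le_one:
  assumes "carrier (ulm R (ulm R N)) = carrier (ulm R N)"
  shows "\<exists>\<tau> :: nat rel. is_ulm_length R N \<tau> \<and> \<tau> \<le>o natLeq_on 1"
proof (cases "carrier (ulm R N) = carrier N")
  \<comment> \<open>The length is 0 if the Ulm submodule is everything and 1 otherwise.\<close>
  case True
  have "is_ulm_length R N ({} :: nat rel)"
    using True ordLess_Field_singleton(2)[of _ "{}"] by (auto simp: is_ulm_length_def ulm_pow_empty)
  moreover have "({} :: nat rel) \<le>o natLeq_on 1"
    using natLeq_on_Well_order[of 1] by (simp add: ordLeq_def embed_def)
  ultimately show ?thesis by blast
next
  case False
  have "is_ulm_length R N (natLeq_on 1)"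
    unfolding is_ulm_length_def ulm_pow_one
  proof (intro conjI allI impI natLeq_on_Well_order assms)
    fix \<sigma> :: "nat rel" assume "\<sigma> <o natLeq_on 1"
    then have "\<sigma> = {}" by (rule ordLess_Field_singleton(1)[where x = 0]) (auto simp: Field_def)
    then show "carrier (ulm R (ulm_pow R N \<sigma>)) \<noteq> carrier (ulm_pow R N \<sigma>)"
      using False by (simp add: ulm_pow_empty)
  qed
  moreover have "natLeq_on 1 \<le>o natLeq_on 1"
    by (rule ordLeq_reflexive) (rule natLeq_on_Well_order)
  ultimately show ?thesis by blast
qed

section \<open>The diagonal embedding\<close>

context definable_ultrapower
begin

text \<open>Elements of \<open>N\<close> are classes of sequences, so \<open>M\<close> can be a
  submodule only up to isomorphism. The map \<open>diag\<close> is that isomorphism onto its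
  image.\<close>

definition diag :: "'m \<Rightarrow> ('j \<Rightarrow> 'm) set" where
  "diag x = cls (\<lambda>_. x)"

lemma diag_inj: "inj_on diag (carrier M)"
  by (rule inj_onI) (simp add: diag_def cls_eq S_const ultra_const[OF ultra])

lemma diag_N: "diag ` carrier M \<subseteq> carrier N"
  by (auto simp: diag_def cls_in_N S_const)

lemma diag_add: "x \<in> carrier M \<Longrightarrow> y \<in> carrier M \<Longrightarrow> diag (x \<oplus>\<^bsub>M\<^esub> y) = diag x \<oplus>\<^bsub>N\<^esub> diag y"
  by (simp add: diag_def N_add S_const)

lemma diag_smult: "r \<in> carrier R \<Longrightarrow> x \<in> carrier M \<Longrightarrow> diag (r \<odot>\<^bsub>M\<^esub> x) = r \<odot>\<^bsub>N\<^esub> diag x"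
  by (simp add: diag_def N_smult S_const)

lemma diag_lin: "diag \<in> lin_maps R M (N\<lparr>carrier := diag ` carrier M\<rparr>)"
  by (simp add: lin_maps_def diag_add diag_smult)

lemma diag_bij: "bij_betw diag (carrier M) (diag ` carrier M)"
  by (rule inj_on_imp_bij_betw[OF diag_inj])

lemma diag_module: "left_module R (N\<lparr>carrier := diag ` carrier M\<rparr>)"
proof (rule N.restrict_left_module[OF diag_N])
  show "x \<oplus>\<^bsub>N\<^esub> y \<in> diag ` carrier M" if "x \<in> diag ` carrier M" "y \<in> diag ` carrier M" for x y
    using that by (auto simp: diag_add[symmetric])
  show "r \<odot>\<^bsub>N\<^esub> x \<in> diag ` carrier M" if "r \<in> carrier R" "x \<in> diag ` carrier M" for r x
    using that by (auto simp: diag_smult[symmetric])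
qed auto

lemma sat_diag:
  assumes "set_mform \<phi> \<subseteq> carrier R" "range s \<subseteq> carrier M"
  shows "sat N (\<lambda>v. diag (s v)) \<phi> \<longleftrightarrow> sat M s \<phi>"
proof -
  have "sat N (\<lambda>v. cls (\<lambda>_. s v)) \<phi> \<longleftrightarrow> eventually (\<lambda>i. sat M (\<lambda>v. s v) \<phi>) V"
    using assms by (intro sat_N) (auto intro: S_const)
  then show ?thesis by (simp add: diag_def ultra_const[OF ultra])
qed

lemma diag_submodule: "submodule (diag ` carrier M) R N"
proof (intro submodule.intro subgroup.intro submodule_axioms.intro)
  interpret D: left_module R "N\<lparr>carrier := diag ` carrier M\<rparr>" by (rule diag_module)
  show "diag ` carrier M \<subseteq> carrier (add_monoid N)" using diag_N by simp
  show "x \<otimes>\<^bsub>add_monoid N\<^esub> y \<in> diag ` carrier M" if "x \<in> diag ` carrier M" "y \<in> diag ` carrier M" for x y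
    using D.M.add.m_closed[of x y] that by simp
  show "\<one>\<^bsub>add_monoid N\<^esub> \<in> diag ` carrier M" using D.M.zero_closed by simp
  show "inv\<^bsub>add_monoid N\<^esub> x \<in> diag ` carrier M" if x: "x \<in> diag ` carrier M" for x
  proof -
    have "(\<ominus>\<^bsub>R\<^esub> \<one>\<^bsub>R\<^esub>) \<odot>\<^bsub>N\<^esub> x \<in> diag ` carrier M"
      using D.smult_closed[of "\<ominus>\<^bsub>R\<^esub> \<one>\<^bsub>R\<^esub>" x] x by simp
    moreover have "(\<ominus>\<^bsub>R\<^esub> \<one>\<^bsub>R\<^esub>) \<odot>\<^bsub>N\<^esub> x = inv\<^bsub>add_monoid N\<^esub> x"
      using x diag_N N.smult_minus_one[of x] unfolding a_inv_def by blast
    ultimately show ?thesis by simp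
  qed
  show "r \<odot>\<^bsub>N\<^esub> x \<in> diag ` carrier M" if "r \<in> carrier R" "x \<in> diag ` carrier M" for r x
    using D.smult_closed[of r x] that by simp
qed

text \<open>Satisfaction in the image is satisfaction in \<open>M\<close> by isomorphism, and this
  is satisfaction in \<open>N\<close> by Los's theorem for constant sequences.\<close>

theorem diag_elementary: "elementary_submodule (diag ` carrier M) R N"
  unfolding elementary_submodule_def
proof (intro conjI allI impI diag_submodule, elim conjE)
  fix \<phi> and s :: "nat \<Rightarrow> ('j \<Rightarrow> 'm) set"
  assume \<phi>: "set_mform \<phi> \<subseteq> carrier R" and s: "range s \<subseteq> diag ` carrier M"
  then have "\<forall>v. \<exists>x. x \<in> carrier M \<and> s v = diag x" by blast
  then obtain s' where s': "\<And>v. s' v \<in> carrier M" "s = (\<lambda>v. diag (s' v))" by metis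
  have "sat (N\<lparr>carrier := diag ` carrier M\<rparr>) s \<phi> \<longleftrightarrow> sat M s' \<phi>"
    unfolding s'(2) using \<phi> s'(1) diag_bij
    by (intro sat_iso[OF left_module_axioms diag_module diag_lin]) auto
  also have "\<dots> \<longleftrightarrow> sat N s \<phi>"
    unfolding s'(2) using \<phi> s'(1) by (intro sat_diag[symmetric]) auto
  finally show "sat (N\<lparr>carrier := diag ` carrier M\<rparr>) s \<phi> \<longleftrightarrow> sat N s \<phi>" .
qed

theorem N_elementarily_equivalent: "elementarily_equivalent R M N"
  unfolding elementarily_equivalent_def
proof (intro allI impI, elim conjE)
  fix \<phi> assume "set_mform \<phi> \<subseteq> carrier R"
  then show "sat M (\<lambda>_. \<zero>\<^bsub>M\<^esub>) \<phi> \<longleftrightarrow> sat N (\<lambda>_. \<zero>\<^bsub>N\<^esub>) \<phi>"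
    using sat_diag[of \<phi> "\<lambda>_. \<zero>\<^bsub>M\<^esub>"] by (simp add: diag_def N_zero)
qed

end

section \<open>Sequences depending on finitely many coordinates\<close>

definition bounded_seqs :: "('r, 'm) module \<Rightarrow> ((nat \<Rightarrow> 'a) \<Rightarrow> 'm) set" where
  "bounded_seqs M = {f. range f \<subseteq> carrier M \<and> (\<exists>k. depends_below k f)}"

text \<open>Finitely many members have a common bound \<open>k\<close>, and any function of their
  values inherits it. This is where the finiteness of the parameter set in
  \<open>S_definable\<close> matters.\<close>

lemma definable_bounded_seqs:
  fixes V :: "(nat \<Rightarrow> 'a) filter" and M :: "('r, 'm) module"
  assumes "left_module R M" "ultra V"
  shows "definable_ultrapower R M V (bounded_seqs M)"
proof -
  interpret left_module R M by fact
  show ?thesis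
  proof
    show "f i \<in> carrier M" if "f \<in> bounded_seqs M" for f and i :: "nat \<Rightarrow> 'a"
      using that by (auto simp: bounded_seqs_def)
    fix X and g :: "(nat \<Rightarrow> 'a) \<Rightarrow> 'm"
    assume X: "finite X" "X \<subseteq> bounded_seqs M" and g: "\<And>i. g i \<in> carrier M"
      "\<And>i j. (\<And>f. f \<in> X \<Longrightarrow> f i = f j) \<Longrightarrow> g i = g j"
    have "\<exists>k. \<forall>f\<in>X. depends_below k f"
      using X
    proof (induction X rule: finite_induct)
      case (insert f X)
      then obtain k l where "depends_below k f" "\<forall>f\<in>X. depends_below l f"
        by (auto simp: bounded_seqs_def)
      then show ?case
        by (intro exI[of _ "max k l"]) (auto intro: depends_below_mono)
    qed simp
    then obtain k where "\<forall>f\<in>X. depends_below k f" ..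
    then have "depends_below k g" unfolding depends_below_def by (blast intro: g(2))
    then show "g \<in> bounded_seqs M" using g(1) by (auto simp: bounded_seqs_def)
  qed (fact assms(2))
qed

theorem corollary6p17:
  fixes R :: "'r ring" and M :: "('r, 'm) module"
  assumes "left_module R M"
  shows "\<exists>(N :: ('r, ('r, 'm) ext) module) H h (\<tau> :: nat rel).
    left_module R N \<and>
    elementary_submodule H R N \<and>
    h \<in> lin_maps R M (N\<lparr>carrier := H\<rparr>) \<and> bij_betw h (carrier M) H \<and>
    elementarily_equivalent R M N \<and>
    is_ulm_length R N \<tau> \<and> \<tau> \<le>o natLeq_on 1"
proof -
  obtain V :: "(nat \<Rightarrow> 'r pp set) filter" where V: "diagonal_ultra V"
    using ex_diagonal_ultra ..
  interpret definable_ultrapower R M V "bounded_seqs M"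
    using V by (intro definable_bounded_seqs assms) (simp add: diagonal_ultra_def)
  have "carrier (ulm R (ulm R N)) = carrier (ulm R N)"
  proof (rule ulm_ulm_eqI[OF N_module])
    fix \<phi> X
    assume \<phi>: "high R \<phi>" and X: "X \<in> carrier (ulm R N)"
    then obtain f where f: "f \<in> bounded_seqs M" "X = cls f" by (auto simp: carrier_ulm N_carrier)
    then obtain k where k: "depends_below k f" by (auto simp: bounded_seqs_def)
    have over: "pp_over R \<phi>" using \<phi> by (simp add: high_def)
    \<comment> \<open>The sets \<open>F\<close> range over all pp formulas, so only their high
      members impose a condition.\<close>
    define Sol where "Sol F x y \<longleftrightarrow> finite F \<and> pp_solution \<phi> M x y \<and>
      (\<forall>j<pp_cols \<phi>. \<forall>\<psi>\<in>{\<psi>\<in>F. high R \<psi>}. y j \<in> pp_set \<psi> M)" for F x y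
    have "eventually (\<lambda>s. \<exists>y. Sol F (f s) y) V" if F: "finite F" for F
    proof -
      let ?F = "{\<psi>\<in>F. high R \<psi>}"
      \<comment> \<open>For a fixed \<open>F\<close> all conditions form one high formula;
        \<open>X\<close> satisfies it as an element of the Ulm submodule, and Los's theorem passes
        it to almost all \<open>s\<close>.\<close>
      have hb: "high R (pp_bound R \<phi> ?F)"
        using F \<phi> by (intro high_bound R.ring_axioms) auto
      then have "cls f \<in> pp_set (pp_bound R \<phi> ?F) N" using X f by (simp add: carrier_ulm)
      then have "eventually (\<lambda>s. f s \<in> pp_set (pp_bound R \<phi> ?F) M) V"
        using hb f by (simp add: pp_set_N high_def)
      moreover have "x \<in> pp_set (pp_bound R \<phi> ?F) M \<longleftrightarrow> x \<in> carrier M \<and> (\<exists>y. Sol F x y)" for x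
        using F by (subst pp_set_bound[OF assms _ over]) (auto simp: Sol_def high_def)
      ultimately show ?thesis by (auto elim: eventually_mono)
    qed
    moreover have "depends_below k (\<lambda>s. \<exists>y. Sol F (f s) y)" for F
      using k unfolding depends_below_def by metis
    \<comment> \<open>Since \<open>f\<close> does not see coordinate \<open>k\<close>, the fixed
      \<open>F\<close> may be replaced by the generic set \<open>s k\<close>, which almost surely
      contains any prescribed \<open>\<psi>\<close>. This is the compactness step.\<close>
    ultimately have ev: "eventually (\<lambda>s. (\<exists>y. Sol (s k) (f s) y) \<and> \<psi> \<in> s k) V" for \<psi>
      by (intro diagonal_ultraD[OF V, where P = "\<lambda>F s. \<exists>y. Sol F (f s) y"])
    define y where "y s = (if \<exists>y. Sol (s k) (f s) y then SOME y. Sol (s k) (f s) y else (\<lambda>_. \<zero>\<^bsub>M\<^esub>))" for s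
    have sol: "Sol (s k) (f s) (y s)" if "\<exists>y. Sol (s k) (f s) y" for s
      using that unfolding y_def by (simp add: someI_ex)
    have yS: "(\<lambda>s. y s j) \<in> bounded_seqs M" if j: "j < pp_cols \<phi>" for j
    proof -
      have "y s j \<in> carrier M" for s
      proof (cases "\<exists>y. Sol (s k) (f s) y")
        case True
        then show ?thesis using sol[OF True] j by (simp add: Sol_def pp_solution_def)
      qed (simp add: y_def)
      \<comment> \<open>The choice uses \<open>f s\<close> and \<open>s k\<close> only, so the
        solution lives exactly one stage above \<open>f\<close>.\<close>
      moreover have "depends_below (Suc k) (\<lambda>s. y s j)"
        unfolding depends_below_def
      proof (intro allI impI)
        fix s t :: "nat \<Rightarrow> 'r pp set" assume st: "\<forall>i<Suc k. s i = t i"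
        then have "f s = f t" "s k = t k" using k by (auto simp: depends_below_def)
        then show "y s j = y t j" by (simp add: y_def)
      qed
      ultimately show ?thesis by (auto simp: bounded_seqs_def)
    qed
    show "\<exists>Y. pp_solution \<phi> N X Y \<and> (\<forall>j<pp_cols \<phi>. Y j \<in> carrier (ulm R N))"
    proof (intro exI conjI allI impI)
      have "eventually (\<lambda>s. pp_solution \<phi> M (f s) (y s)) V"
        by (rule eventually_mono[OF ev]) (use sol in \<open>auto simp: Sol_def\<close>)
      then show "pp_solution \<phi> N X (\<lambda>j. cls (\<lambda>s. y s j))"
        using f over yS by (simp add: pp_solution_N)
      fix j assume j: "j < pp_cols \<phi>"
      \<comment> \<open>One solution serves all \<open>\<psi>\<close>: it was chosen independently
        of \<open>\<psi>\<close>, and only the set of good \<open>s\<close> varies with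
        \<open>\<psi>\<close>.\<close>
      have "cls (\<lambda>s. y s j) \<in> pp_set \<psi> N" if \<psi>: "high R \<psi>" for \<psi>
      proof -
        have "eventually (\<lambda>s. y s j \<in> pp_set \<psi> M) V"
          by (rule eventually_mono[OF ev[of \<psi>]]) (use sol \<psi> j in \<open>auto simp: Sol_def\<close>)
        then show ?thesis using \<psi> yS[OF j] by (simp add: pp_set_N high_def)
      qed
      then show "cls (\<lambda>s. y s j) \<in> carrier (ulm R N)"
        using yS[OF j] by (simp add: carrier_ulm cls_in_N)
    qed
  qed
  then obtain \<tau> :: "nat rel" where "is_ulm_length R N \<tau>" "\<tau> \<le>o natLeq_on 1"
    using ulm_length_le_one by blast
  then show ?thesis
    using N_module diag_elementary diag_lin diag_bij N_elementarily_equivalent by blast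
qed

end
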